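(* There is an algorithm that, given integers $\ell \ge 1$ and $k \geq \ell + 4$ and an $n$-vertex (finite, simple, undirected) graph $G$ as input, computes the number of $k$-element subsets $X \subseteq V(G)$ such that the induced subgraph $G[X]$ is an $\ell$-scorpion, in time $O(\ell \cdot n^{\ell + 3})$.
   Context: Graphs are finite, simple and undirected; $\mathbb{N}=\{1,2,3,\dots\}$. For $\ell\in\mathbb{N}$, an $\ell$-scorpion is a graph $H$ with $|V(H)|\ge \ell+4$ that admits a tuple of pairwise distinct vertices $(b,t_1,\dots,t_\ell,s)\in V(H)^{\ell+2}$ ($b$ is called the body, $t_1,\dots,t_\ell$ the tail, $s$ the sting) such that, writing $Q=\{b,t_1,\dots,t_\ell,s\}$ and calling the vertices in $V(H)\setminus Q$ legs: (i) $H[Q]$ is an induced path from $b$ to $s$ whose vertices in order are $b,t_1,\dots,t_\ell,s$ (i.e. the edges of $H[Q]$ are exactly those between consecutive vertices of this sequence); (ii) $b$ is adjacent to all legs; (iii) $b$ is the only vertex in $Q$ adjacent to legs. Edges between legs are unrestricted. The constant hidden in the $O$-notation is independent of $\ell$, $k$ and $G$. *)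

theory Defs
  imports "Graph_Theory.Graph_Theory"
begin

section \<open>Scorpions\<close>

text \<open>
  Undirected simple graphs are the symmetric loop-free digraphs without parallel arcs of
  \<^locale>\<open>graph\<close>; \<open>u\<close> and \<open>v\<close> are adjacent iff
  \<open>u \<rightarrow>\<^bsub>H\<^esub> v\<close>.  In the list \<open>q = b # ts @ [s]\<close> the body is \<open>q ! 0\<close>, the tail is
  \<open>q ! 1, \<dots>, q ! l\<close> and the sting is \<open>q ! (l + 1)\<close>; the legs are the vertices outside \<open>set q\<close>.
\<close>

definition scorpion :: "nat \<Rightarrow> ('a, 'b) pre_digraph \<Rightarrow> bool" where
  "scorpion l H \<longleftrightarrow>
     graph H \<and> l + 4 \<le> card (verts H) \<and>
     (\<exists>b ts s. let q = b # ts @ [s] in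
        length ts = l \<and> distinct q \<and> set q \<subseteq> verts H \<and>
        (\<forall>i < l + 2. \<forall>j < l + 2. q ! i \<rightarrow>\<^bsub>H\<^esub> q ! j \<longleftrightarrow> j = i + 1 \<or> i = j + 1) \<and>
        (\<forall>v \<in> verts H - set q. b \<rightarrow>\<^bsub>H\<^esub> v) \<and>
        (\<forall>x \<in> set q - {b}. \<forall>v \<in> verts H - set q. \<not> x \<rightarrow>\<^bsub>H\<^esub> v))"

definition count_induced_scorpions :: "nat \<Rightarrow> nat \<Rightarrow> 'a pair_pre_digraph \<Rightarrow> nat" where
  "count_induced_scorpions l k G =
     card {X. X \<subseteq> pverts G \<and> card X = k \<and> scorpion l (with_proj G \<restriction> X)}"

section \<open>Word RAM\<close>

text \<open>
  Algorithms are programs for a word RAM with word length \<open>w\<close>: finitely many registers (those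
  named in the program) and a memory addressed by words.  Arithmetic is modulo \<open>2 ^ w\<close>, and every
  elementary instruction and every evaluation of a test takes one unit of time.  A program does
  not depend on \<open>w\<close>.  Neither division nor bitwise operations are available.
\<close>

type_synonym reg = nat

datatype arith_op = Plus | Minus | Times

datatype test = Eq reg reg | Less reg reg

datatype com =
    Nop
  | SetConst reg nat
  | Arith arith_op reg reg reg \<comment> \<open>destination register first\<close>
  | Load reg reg               \<comment> \<open>destination register, address register\<close>
  | Store reg reg              \<comment> \<open>address register, source register\<close>
  | Seq com com
  | Ite test com com
  | Loop test com

record ram_state =
  regs :: "reg \<Rightarrow> nat"
  mem :: "nat \<Rightarrow> nat"

fun word_arith :: "nat \<Rightarrow> arith_op \<Rightarrow> nat \<Rightarrow> nat \<Rightarrow> nat" where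
  "word_arith w Plus x y = (x + y) mod 2 ^ w"
| "word_arith w Minus x y = nat ((int x - int y) mod 2 ^ w)"
| "word_arith w Times x y = (x * y) mod 2 ^ w"

fun holds :: "test \<Rightarrow> ram_state \<Rightarrow> bool" where
  "holds (Eq a b) s \<longleftrightarrow> regs s a = regs s b"
| "holds (Less a b) s \<longleftrightarrow> regs s a < regs s b"

abbreviation set_reg :: "reg \<Rightarrow> nat \<Rightarrow> ram_state \<Rightarrow> ram_state" where
  "set_reg r x s \<equiv> s\<lparr>regs := (regs s)(r := x)\<rparr>"

text \<open>\<open>exec w c s t s'\<close>: with word length \<open>w\<close>, program \<open>c\<close> started in state \<open>s\<close> halts in
  state \<open>s'\<close> after exactly \<open>t\<close> time units.\<close>

inductive exec :: "nat \<Rightarrow> com \<Rightarrow> ram_state \<Rightarrow> nat \<Rightarrow> ram_state \<Rightarrow> bool" for w where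
  Nop: "exec w Nop s 1 s"
| SetConst: "exec w (SetConst r c) s 1 (set_reg r (c mod 2 ^ w) s)"
| Arith: "exec w (Arith f r a b) s 1 (set_reg r (word_arith w f (regs s a) (regs s b)) s)"
| Load: "exec w (Load r a) s 1 (set_reg r (mem s (regs s a)) s)"
| Store: "exec w (Store a r) s 1 (s\<lparr>mem := (mem s)(regs s a := regs s r)\<rparr>)"
| Seq: "exec w c1 s t1 s' \<Longrightarrow> exec w c2 s' t2 s'' \<Longrightarrow> exec w (Seq c1 c2) s (t1 + t2) s''"
| IteTrue: "holds e s \<Longrightarrow> exec w c1 s t s' \<Longrightarrow> exec w (Ite e c1 c2) s (t + 1) s'"
| IteFalse: "\<not> holds e s \<Longrightarrow> exec w c2 s t s' \<Longrightarrow> exec w (Ite e c1 c2) s (t + 1) s'"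
| LoopFalse: "\<not> holds e s \<Longrightarrow> exec w (Loop e c) s 1 s"
| LoopTrue: "holds e s \<Longrightarrow> exec w c s t1 s' \<Longrightarrow> exec w (Loop e c) s' t2 s'' \<Longrightarrow>
    exec w (Loop e c) s (t1 + t2 + 1) s''"

lemma exec_deterministic:
  "exec w c s t s' \<Longrightarrow> exec w c s u s'' \<Longrightarrow> t = u \<and> s' = s''"
proof (induction arbitrary: u s'' rule: exec.induct)
  case (Seq c1 s t1 s1 c2 t2 s2)
  from Seq.prems show ?case by cases (use Seq.IH in blast)
next
  case (IteTrue e s c1 t s1 c2)
  from IteTrue.prems show ?case by cases (use IteTrue in blast)+
next
  case (IteFalse e s c2 t s1 c1)
  from IteFalse.prems show ?case by cases (use IteFalse in blast)+
next
  case (LoopTrue e s c t1 s1 t2 s2)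
  from LoopTrue.prems show ?case by cases (use LoopTrue in blast)+
qed (erule exec.cases; simp)+

section \<open>Input and output conventions\<close>

text \<open>The vertices of an \<open>n\<close>-vertex input graph are \<open>0, \<dots>, n - 1\<close>.  Its adjacency matrix is
  stored row by row from address \<open>0\<close> on; registers \<open>0\<close>, \<open>1\<close>, \<open>2\<close> contain \<open>n\<close>, \<open>l\<close>, \<open>k\<close>.\<close>

definition input_state :: "nat \<Rightarrow> nat \<Rightarrow> nat \<Rightarrow> nat pair_pre_digraph \<Rightarrow> ram_state" where
  "input_state n l k G =
     \<lparr>regs = (\<lambda>_. 0)(0 := n, 1 := l, 2 := k),
      mem = (\<lambda>a. if a < n * n \<and> (a div n, a mod n) \<in> parcs G then 1 else 0)\<rparr>"

text \<open>The count can be exponential in \<open>n\<close> and so need not fit into one word.  The output is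
  therefore a number in base \<open>2 ^ w\<close>, least significant digit first: register \<open>0\<close> contains the number
  of digits and register \<open>1\<close> the address of the first one.\<close>

definition has_output :: "nat \<Rightarrow> ram_state \<Rightarrow> nat \<Rightarrow> bool" where
  "has_output w s N \<longleftrightarrow>
     regs s 1 + regs s 0 \<le> 2 ^ w \<and>
     N = (\<Sum>i < regs s 0. mem s (regs s 1 + i) * (2 ^ w) ^ i)"

text \<open>
  The usual word-size convention is that a word has at least \<open>d * log 2 N\<close> bits, for inputs
  of magnitude \<open>N\<close> and some constant \<open>d \<ge> 1\<close> that depends only on the program.  It ensures that
  numbers and addresses polynomial in \<open>n\<close>, \<open>l\<close> and \<open>k\<close> are words.  The summand \<open>2\<close> keeps the base
  of the power above one.
\<close>

definition admissible_word_size :: "nat \<Rightarrow> nat \<Rightarrow> nat \<Rightarrow> nat \<Rightarrow> nat \<Rightarrow> bool" where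
  "admissible_word_size d w n l k \<longleftrightarrow> (n + l + k + 2) ^ d \<le> 2 ^ w"

end

theory Submission
  imports Defs
begin

text \<open>
  In a scorpion with at least two legs the tuple (body, tail, sting) is unique: the body is the
  only vertex outside the legs of degree at least three, and from there the path is forced.  Hence
  the count is the sum, over all induced paths \<open>q\<close> on \<open>l + 2\<close> vertices, of \<open>m choose (k - l - 2)\<close>,
  where \<open>m\<close> is the number of vertices that are adjacent to the first vertex of \<open>q\<close> and to no
  other.  The program runs through all \<open>n ^ (l + 2)\<close> tuples with an odometer in base \<open>n\<close>, spends
  time \<open>O(l * n)\<close> on each of them, and adds up the binomial coefficients, which are taken from
  Pascal's triangle; all of these numbers are at most \<open>2 ^ n\<close> and fit into \<open>n\<close> words.
\<close>

section \<open>Counting by induced paths\<close>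

text \<open>Since edges between legs are unrestricted, a leg may have any degree, so degrees alone
  do not locate the body: the case that each of two bodies is a leg for the other path needs a
  separate argument through the neighbour \<open>q ! 1\<close>. Degree three takes two legs, which
  \<open>l + 4 \<le> k\<close> provides; fixing the second path vertex takes a third one, hence
  \<open>1 \<le> l\<close>.

  On the machine, a tuple costs \<open>O(L * L)\<close> for the path test, \<open>O(L * n)\<close>
  for the legs and \<open>O(n)\<close> for the multi-word addition. This is \<open>O(l * n)\<close>
  once \<open>L \<le> n\<close>, which is why \<open>n < k\<close> is answered separately. The
  number \<open>n ^ L\<close> of tuples need not fit into a word, so no register can count them.
  Without division, the binomial coefficients come from additions only; the table of
  \<open>(n + 1) ^ 2\<close> numbers with \<open>n\<close> words each is the cubic memory behind the
  exponent 4 in the word size.\<close>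

text \<open>\<open>matches R q p v\<close>: \<open>v\<close> has the adjacencies of position \<open>p\<close> on the path, where \<open>q ! i\<close> is at
  position \<open>i + 1\<close>.  Legs are exactly the vertices that could precede the body, at position \<open>0\<close>.\<close>

definition matches :: "('a \<Rightarrow> 'a \<Rightarrow> bool) \<Rightarrow> 'a list \<Rightarrow> nat \<Rightarrow> 'a \<Rightarrow> bool" where
  "matches R q p v \<longleftrightarrow>
     (\<forall>i < length q. (R (q ! i) v \<longleftrightarrow> i = p \<or> i + 2 = p) \<and> (q ! i = v \<longrightarrow> i + 1 = p))"

text \<open>Phrased through \<open>matches\<close>, so that the single routine
  \<open>match_prog\<close> tests path vertices and legs alike.\<close>

definition ind_path :: "('a \<Rightarrow> 'a \<Rightarrow> bool) \<Rightarrow> 'a list \<Rightarrow> bool" where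
  "ind_path R q \<longleftrightarrow> (\<forall>j < length q. matches R q (j + 1) (q ! j))"

abbreviation leg :: "('a \<Rightarrow> 'a \<Rightarrow> bool) \<Rightarrow> 'a list \<Rightarrow> 'a \<Rightarrow> bool" where
  "leg R q v \<equiv> matches R q 0 v"

lemma leg_iff:
  "leg R q v \<longleftrightarrow> v \<notin> set q \<and> (\<forall>i < length q. R (q ! i) v \<longleftrightarrow> i = 0)"
  by (auto simp: matches_def in_set_conv_nth)

lemma ind_path_iff:
  "ind_path R q \<longleftrightarrow> distinct q \<and>
     (\<forall>i < length q. \<forall>j < length q. R (q ! i) (q ! j) \<longleftrightarrow> j = i + 1 \<or> i = j + 1)"
  by (auto simp: ind_path_def matches_def distinct_conv_nth)

lemma ind_path_arc:
  assumes "ind_path R q" "i < length q" "j < length q"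
  shows "R (q ! i) (q ! j) \<longleftrightarrow> j = i + 1 \<or> i = j + 1"
  using assms unfolding ind_path_iff by blast

lemma leg_arc:
  assumes "leg R q v" "i < length q"
  shows "R (q ! i) v \<longleftrightarrow> i = 0"
  using assms unfolding leg_iff by blast

text \<open>Legs see only the body, so an inner vertex has only its neighbours on the path. For the
  sting, \<open>q ! (i + 1)\<close> is beyond the list and unspecified; this is harmless in an upper
  bound.\<close>

lemma nbhd_inner_subset:
  assumes q: "ind_path R q" and Y: "\<forall>v\<in>Y. leg R q v" and i: "0 < i" "i < length q"
  shows "{v \<in> set q \<union> Y. R (q ! i) v} \<subseteq> {q ! (i - 1), q ! (i + 1)}"
proof
  fix v assume v: "v \<in> {v \<in> set q \<union> Y. R (q ! i) v}"
  then have "v \<in> set q" using Y i by (auto simp: leg_iff)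
  then obtain j where j: "j < length q" "v = q ! j" by (auto simp: in_set_conv_nth)
  with q v i have "j = i + 1 \<or> i = j + 1" by (auto simp: ind_path_iff)
  with j show "v \<in> {q ! (i - 1), q ! (i + 1)}" by auto
qed

text \<open>The body is the only non-leg of degree at least three.\<close>

lemma body_not_inner:
  assumes q: "ind_path R q" "\<forall>v\<in>Y. leg R q v" and q': "ind_path R q'" "\<forall>v\<in>Y'. leg R q' v"
    and X: "set q \<union> Y = set q' \<union> Y'"
    and len: "2 \<le> length q'" and card: "2 \<le> card Y'" and i: "0 < i" "i < length q"
  shows "q' ! 0 \<noteq> q ! i"
proof
  assume eq: "q' ! 0 = q ! i"
  have pos: "0 < length q'" "1 < length q'" using len by linarith+
  have "R (q' ! 0) (q' ! 1)" using ind_path_arc[OF q'(1) pos] by simp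
  \<comment> \<open>The body of \<open>q'\<close> has at least three neighbours, its successor and
    two legs, and they would all have to lie in a set of two vertices.\<close>
  then have "insert (q' ! 1) Y' \<subseteq> {v \<in> set q' \<union> Y'. R (q' ! 0) v}"
    using q'(2) pos leg_arc[of R q' _ 0] by auto
  also have "\<dots> \<subseteq> {q ! (i - 1), q ! (i + 1)}"
    using nbhd_inner_subset[OF q i] unfolding X eq .
  finally have sub: "insert (q' ! 1) Y' \<subseteq> {q ! (i - 1), q ! (i + 1)}" .
  then have "card (insert (q' ! 1) Y') \<le> card {q ! (i - 1), q ! (i + 1)}"
    by (intro card_mono) auto
  also have "\<dots> \<le> 2" by (simp add: card_insert_if)
  finally have "card (insert (q' ! 1) Y') \<le> 2" .
  moreover have "q' ! 1 \<notin> Y'" using q' len by (auto simp: leg_iff)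
  moreover have "finite Y'" using card by (metis card.infinite not_numeral_le_zero)
  ultimately show False using card by simp
qed

text \<open>By \<open>body_not_inner\<close>, each body is the other body or a leg for the other
  path. Once the first two vertices agree, every further vertex is forced, as inner vertices have no
  neighbours off the path.\<close>

lemma scorpion_path_unique:
  assumes sym: "\<And>u v. R u v \<Longrightarrow> R v u"
    and q: "ind_path R q" "\<forall>v\<in>Y. leg R q v" and q': "ind_path R q'" "\<forall>v\<in>Y'. leg R q' v"
    and X: "set q \<union> Y = set q' \<union> Y'"
    and len: "3 \<le> length q" "length q' = length q" and card: "2 \<le> card Y" "2 \<le> card Y'"
  shows "q = q'"
proof -
  have pos: "0 < length q" "1 < length q" "2 < length q"
    "0 < length q'" "1 < length q'" "2 < length q'" using len by linarith+
  have inX: "q ! i \<in> Y' \<or> (\<exists>j < length q'. q ! i = q' ! j)" if "i < length q" for i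
    using nth_mem[OF that] X by (metis UnE UnI1 in_set_conv_nth)
  have inX': "q' ! i \<in> Y \<or> (\<exists>j < length q. q' ! i = q ! j)" if "i < length q'" for i
    using nth_mem[OF that] X by (metis UnE UnI1 in_set_conv_nth)
  have n1: "q' ! 0 \<noteq> q ! i" if "0 < i" "i < length q" for i
    using body_not_inner[OF q q' X _ card(2)] len that by auto
  have n2: "q ! 0 \<noteq> q' ! i" if "0 < i" "i < length q'" for i
    using body_not_inner[OF q' q X[symmetric] _ card(1)] len that by auto
  have b: "q' ! 0 = q ! 0"
  proof (rule ccontr)
    assume ne: "q' ! 0 \<noteq> q ! 0"
    have "q' ! 0 \<in> Y" using inX'[OF pos(4)] n1 ne by (metis gr0I)
    then have bY: "leg R q (q' ! 0)" using q by blast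
    have "q ! 0 \<in> Y'" using inX[OF pos(1)] n2 ne by (metis gr0I)
    then have bY': "leg R q' (q ! 0)" using q' by blast
    \<comment> \<open>The leg \<open>q' ! 0\<close> of \<open>q\<close> misses \<open>q ! 1\<close>,
      whereas all legs of \<open>q'\<close> are adjacent to \<open>q' ! 0\<close>; so
      \<open>q ! 1\<close> is on \<open>q'\<close>. As it is adjacent to \<open>q ! 0\<close>, a leg
      of \<open>q'\<close>, it must be \<open>q' ! 0\<close>, but a leg of \<open>q\<close> is not
      on \<open>q\<close>.\<close>
    have na: "\<not> R (q' ! 0) (q ! 1)" "q ! 1 \<noteq> q' ! 0"
      using leg_arc[OF bY pos(2)] sym bY nth_mem[OF pos(2)] by (auto simp: leg_iff)
    then have "q ! 1 \<notin> Y'" using q'(2) leg_arc[OF _ pos(4)] by blast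
    then obtain i where i: "i < length q'" "q ! 1 = q' ! i" using inX[OF pos(2)] by blast
    have "R (q' ! i) (q ! 0)" using ind_path_arc[OF q(1) pos(2,1)] unfolding i(2)[symmetric] by simp
    then have "i = 0" using leg_arc[OF bY' i(1)] by simp
    with i na show False by simp
  qed
  have q1: "q' ! 1 = q ! 1"
  proof (rule ccontr)
    assume ne: "q' ! 1 \<noteq> q ! 1"
    have arc: "R (q ! 0) (q' ! 1)" 
      using ind_path_arc[OF q'(1) pos(4,5)] unfolding b by simp
    have "q' ! 1 \<in> Y"
      using inX'[OF pos(5)] arc ne ind_path_arc[OF q(1) pos(1)] by fastforce
    then have legq: "leg R q (q' ! 1)" using q by blast
    \<comment> \<open>The third vertex of \<open>q'\<close> misses the common body, so it is no leg
      of \<open>q\<close>; but it sees the leg \<open>q' ! 1\<close>, which on \<open>q\<close> only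
      the body does.\<close>
    have a2: "R (q' ! 1) (q' ! 2)" "\<not> R (q ! 0) (q' ! 2)" "q' ! 2 \<noteq> q ! 0" 
      using ind_path_arc[OF q'(1) pos(5,6)] ind_path_arc[OF q'(1) pos(4,6)] n2[of 2] pos
      unfolding b by auto
    have "q' ! 2 \<notin> Y" using a2 q(2) leg_arc[OF _ pos(1)] by blast
    then obtain i where i: "i < length q" "q' ! 2 = q ! i" using inX'[OF pos(6)] by blast
    with a2(1) sym have "i = 0" using leg_arc[OF legq i(1)] by simp
    with i a2 show False by simp
  qed
  have "\<forall>j \<le> i. q' ! j = q ! j" if "i < length q" for i
    using that
  proof (induction i)
    case 0 with b show ?case by simp
  next
    case (Suc i)
    then have IH: "\<forall>j \<le> i. q' ! j = q ! j" by simp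
    have "q' ! Suc i = q ! Suc i"
    proof (cases "i = 0")
      case True with q1 show ?thesis by simp
    next
      case False
      from Suc.prems len have i: "i < length q'" "i - 1 < length q'" "Suc i < length q'" by auto
      have "R (q ! i) (q' ! Suc i)"
        using ind_path_arc[OF q'(1) i(1,3)] IH by simp
      moreover have "q' ! Suc i \<in> set q \<union> Y" using inX'[OF i(3)] by auto
      ultimately have "q' ! Suc i = q ! (i - 1) \<or> q' ! Suc i = q ! (i + 1)"
        using nbhd_inner_subset[OF q, of i] False Suc.prems by auto
      \<comment> \<open>Of the two possible neighbours, the predecessor already occurs in
        \<open>q'\<close>.\<close>
      moreover have "q' ! Suc i \<noteq> q' ! (i - 1)"
        using q'(1) i by (auto simp: ind_path_iff nth_eq_iff_index_eq)
      ultimately show ?thesis using IH by auto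
    qed
    with IH show ?case by (auto simp: le_Suc_eq)
  qed
  then have "q ! i = q' ! i" if "i < length q" for i using that by simp
  then show ?thesis using len by (intro nth_equalityI) auto
qed

section \<open>Induced scorpions as pairs of an induced path and a set of legs\<close>

lemma scorpion_induced_iff:
  assumes G: "pair_graph G" and X: "X \<subseteq> pverts G"
  shows "scorpion l (with_proj G \<restriction> X) \<longleftrightarrow> l + 4 \<le> card X \<and>
    (\<exists>q. length q = l + 2 \<and> set q \<subseteq> X \<and> ind_path (\<lambda>u v. (u, v) \<in> parcs G) q \<and>
      (\<forall>v \<in> X - set q. leg (\<lambda>u v. (u, v) \<in> parcs G) q v))" (is "_ \<longleftrightarrow> _ \<and> (\<exists>q. ?P q)")
proof -
  interpret pair_graph G by fact
  have fin: "finite X" using X pair_finite_verts finite_subset by blast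
  have graph: "graph (with_proj G \<restriction> X)"
  proof -
    interpret GX: wf_digraph "with_proj G \<restriction> X" by (rule wellformed_induce_subgraph)
    show ?thesis
    proof unfold_locales
      show "symmetric (with_proj G \<restriction> X)"
        using pair_sym_arcs by (auto simp: symmetric_def arcs_ends_conv sym_def)
    qed (use fin no_loops pair_finite_arcs in \<open>auto simp: arc_to_ends_def prod_eq_iff\<close>)
  qed
  have dom: "u \<rightarrow>\<^bsub>with_proj G \<restriction> X\<^esub> v \<longleftrightarrow> u \<in> X \<and> v \<in> X \<and> (u, v) \<in> parcs G" for u v
    by (auto simp: arcs_ends_conv)
  have *: "(length ts = l \<and> distinct q \<and> set q \<subseteq> X \<and>
        (\<forall>i < l + 2. \<forall>j < l + 2. q ! i \<rightarrow>\<^bsub>with_proj G \<restriction> X\<^esub> q ! j \<longleftrightarrow> j = i + 1 \<or> i = j + 1) \<and>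
        (\<forall>v \<in> X - set q. b \<rightarrow>\<^bsub>with_proj G \<restriction> X\<^esub> v) \<and>
        (\<forall>x \<in> set q - {b}. \<forall>v \<in> X - set q. \<not> x \<rightarrow>\<^bsub>with_proj G \<restriction> X\<^esub> v)) \<longleftrightarrow> ?P q" (is "?A \<longleftrightarrow> _")
    if q: "q = b # ts @ [s]" for q b ts s
  proof (cases "length q = l + 2 \<and> set q \<subseteq> X \<and> distinct q")
    case True
    have b: "b = q ! 0" and len: "length ts = l" "length q = l + 2" using q True by auto
    have mem: "q ! i \<in> X" if "i < l + 2" for i using True that by (auto simp: subset_iff)
    have set: "x \<in> set q - {b} \<longleftrightarrow> (\<exists>i<l+2. 0 < i \<and> x = q ! i)" for x
      unfolding b using True
      by (auto simp: in_set_conv_nth nth_eq_iff_index_eq)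
    have "(\<forall>x \<in> set q - {b}. \<forall>v \<in> X - set q. \<not> x \<rightarrow>\<^bsub>with_proj G \<restriction> X\<^esub> v) \<longleftrightarrow>
        (\<forall>i < l + 2. 0 < i \<longrightarrow> (\<forall>v \<in> X - set q. \<not> (q ! i) \<rightarrow>\<^bsub>with_proj G \<restriction> X\<^esub> v))"
      using set by (metis (no_types, lifting))
    also have "\<dots> \<longleftrightarrow> (\<forall>v \<in> X - set q. \<forall>i < l + 2. 0 < i \<longrightarrow> (q ! i, v) \<notin> parcs G)"
      using mem unfolding dom by blast
    finally have legs1: "(\<forall>x \<in> set q - {b}. \<forall>v \<in> X - set q. \<not> x \<rightarrow>\<^bsub>with_proj G \<restriction> X\<^esub> v) \<longleftrightarrow>
        (\<forall>v \<in> X - set q. \<forall>i < l + 2. 0 < i \<longrightarrow> (q ! i, v) \<notin> parcs G)" .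
    have legs0: "(\<forall>v \<in> X - set q. b \<rightarrow>\<^bsub>with_proj G \<restriction> X\<^esub> v) \<longleftrightarrow>
        (\<forall>v \<in> X - set q. (q ! 0, v) \<in> parcs G)"
      using mem[of 0] unfolding dom b by auto
    have leg: "leg (\<lambda>u v. (u, v) \<in> parcs G) q v \<longleftrightarrow>
      (q ! 0, v) \<in> parcs G \<and> (\<forall>i < l + 2. 0 < i \<longrightarrow> (q ! i, v) \<notin> parcs G)" if "v \<in> X - set q" for v
      using that len by (auto simp: leg_iff)
    have legs: "(\<forall>v \<in> X - set q. b \<rightarrow>\<^bsub>with_proj G \<restriction> X\<^esub> v) \<and>
        (\<forall>x \<in> set q - {b}. \<forall>v \<in> X - set q. \<not> x \<rightarrow>\<^bsub>with_proj G \<restriction> X\<^esub> v) \<longleftrightarrow>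
        (\<forall>v \<in> X - set q. leg (\<lambda>u v. (u, v) \<in> parcs G) q v)"
      unfolding legs0 legs1 using leg by blast
    have path: "(\<forall>i < l + 2. \<forall>j < l + 2. q ! i \<rightarrow>\<^bsub>with_proj G \<restriction> X\<^esub> q ! j \<longleftrightarrow> j = i + 1 \<or> i = j + 1)
        \<longleftrightarrow> ind_path (\<lambda>u v. (u, v) \<in> parcs G) q"
      unfolding ind_path_iff dom len using True mem by blast
    show ?thesis unfolding path legs using True len by blast
  next
    case False
    with q show ?thesis by (auto simp: ind_path_iff)
  qed
  have split: "\<exists>b ts s. q = b # ts @ [s]" if "length q = l + 2" for q :: "'a list"
  proof -
    from that obtain b q' where "q = b # q'" "length q' = Suc l" by (cases q) auto
    moreover then obtain ts s where "q' = ts @ [s]" by (cases q' rule: rev_cases) auto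
    ultimately show ?thesis by blast
  qed
  have "(\<exists>b ts s. ?P (b # ts @ [s])) \<longleftrightarrow> (\<exists>q. ?P q)"
    using split by metis
  then show ?thesis
    unfolding scorpion_def Let_def induce_subgraph_verts *[OF refl] using graph by simp
qed

text \<open>Any \<open>k - (l + 2)\<close> of the possible legs complete \<open>q\<close> to a
  scorpion, because edges among them do not matter; \<open>scorpion_path_unique\<close> shows that
  no vertex set arises twice. The sum is over all lists, with value 0 off the induced paths, because
  the program visits every tuple.\<close>

lemma count_induced_scorpions_eq_sum:
  assumes G: "pair_graph G" and l: "1 \<le> l" and k: "l + 4 \<le> k"
  defines "R \<equiv> \<lambda>u v. (u, v) \<in> parcs G"
  shows "count_induced_scorpions l k G =
    (\<Sum>q | length q = l + 2 \<and> set q \<subseteq> pverts G.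
       if ind_path R q then card {v \<in> pverts G. leg R q v} choose (k - (l + 2)) else 0)"
proof -
  interpret pair_graph G by fact
  have sym: "R v u" if "R u v" for u v
    using that pair_sym_arcs by (auto simp: R_def symmetric_def sym_def)
  define V where "V = pverts G"
  have fin: "finite V" unfolding V_def by (rule pair_finite_verts)
  define Q where "Q = {q. (length q = l + 2 \<and> set q \<subseteq> V) \<and> ind_path R q}"
  define Y where "Y q = {Y. Y \<subseteq> {v \<in> V. leg R q v} \<and> card Y = k - (l + 2)}" for q
  have finQ': "finite {q. length q = l + 2 \<and> set q \<subseteq> V}"
    using finite_lists_length_eq[OF fin, of "l + 2"] by (simp add: conj_commute)
  have finQ: "finite Q" unfolding Q_def by (rule finite_subset[OF _ finQ']) auto
  have finY: "finite (Y q)" for q unfolding Y_def using fin by simp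
  have set_diff: "set q \<union> Z - set q = Z" if "Z \<in> Y q" for q Z
    using that by (auto simp: Y_def leg_iff)
  have bij: "bij_betw (\<lambda>(q, Z). set q \<union> Z) (SIGMA q:Q. Y q)
    {X. X \<subseteq> V \<and> card X = k \<and> scorpion l (with_proj G \<restriction> X)}"
    unfolding bij_betw_def
  proof
    show "inj_on (\<lambda>(q, Z). set q \<union> Z) (SIGMA q:Q. Y q)"
    proof (rule inj_onI, clarify)
      fix q Z q' Z'
      assume q: "q \<in> Q" "q' \<in> Q" and Z: "Z \<in> Y q" "Z' \<in> Y q'"
        and eq: "set q \<union> Z = set q' \<union> Z'"
      have "q = q'"
        by (rule scorpion_path_unique[OF sym _ _ _ _ eq]) (use q Z l k in \<open>auto simp: Q_def Y_def\<close>)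
      with set_diff[of Z q] set_diff[of Z' q'] Z eq show "q = q' \<and> Z = Z'" by metis
    qed
    have card: "card (set q \<union> Z) = k" if "q \<in> Q" "Z \<in> Y q" for q Z
    proof -
      have "card (set q \<union> Z) = card (set q) + card Z"
        using that fin by (intro card_Un_disjoint) (auto simp: Y_def leg_iff dest: finite_subset)
      moreover have "card (set q) = l + 2" 
        using that by (auto simp: Q_def ind_path_iff distinct_card)
      ultimately show ?thesis using that k by (auto simp: Y_def)
    qed
    show "(\<lambda>(q, Z). set q \<union> Z) ` (SIGMA q:Q. Y q) =
      {X. X \<subseteq> V \<and> card X = k \<and> scorpion l (with_proj G \<restriction> X)}"
    proof (intro equalityI subsetI)
      fix X assume "X \<in> (\<lambda>(q, Z). set q \<union> Z) ` (SIGMA q:Q. Y q)"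
      then obtain q Z where q: "q \<in> Q" "Z \<in> Y q" "X = set q \<union> Z" by auto
      then have "X \<subseteq> V" by (auto simp: Q_def Y_def)
      moreover have "\<exists>q. length q = l + 2 \<and> set q \<subseteq> X \<and> ind_path R q \<and> (\<forall>v \<in> X - set q. leg R q v)"
        using q by (intro exI[of _ q]) (auto simp: Q_def Y_def)
      ultimately show "X \<in> {X. X \<subseteq> V \<and> card X = k \<and> scorpion l (with_proj G \<restriction> X)}"
        using scorpion_induced_iff[OF G, of X l] card[OF q(1,2)] q(3) k by (simp add: V_def R_def)
    next
      fix X assume "X \<in> {X. X \<subseteq> V \<and> card X = k \<and> scorpion l (with_proj G \<restriction> X)}"
      then obtain q where X: "X \<subseteq> V" "card X = k" and q: "length q = l + 2" "set q \<subseteq> X" "ind_path R q"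
        "\<forall>v \<in> X - set q. leg R q v"
        using scorpion_induced_iff[OF G, of X l] by (auto simp: V_def R_def)
      have "card (X - set q) = k - (l + 2)"
        using q X by (subst card_Diff_subset) (auto simp: ind_path_iff distinct_card)
      then have "(q, X - set q) \<in> (SIGMA q:Q. Y q)" using q X by (auto simp: Q_def Y_def)
      moreover have "X = set q \<union> (X - set q)" using q by auto
      ultimately show "X \<in> (\<lambda>(q, Z). set q \<union> Z) ` (SIGMA q:Q. Y q)"
        by (metis (mono_tags, lifting) case_prod_conv image_eqI)
    qed
  qed
  have "count_induced_scorpions l k G = card (SIGMA q:Q. Y q)"
    using bij_betw_same_card[OF bij] unfolding count_induced_scorpions_def V_def by simp
  also have "\<dots> = (\<Sum>q\<in>Q. card (Y q))" using finQ finY by (intro card_SigmaI) auto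
  also have "\<dots> = (\<Sum>q\<in>Q. card {v \<in> V. leg R q v} choose (k - (l + 2)))"
    unfolding Y_def using fin by (intro sum.cong refl n_subsets) simp
  also have "\<dots> = (\<Sum>q | length q = l + 2 \<and> set q \<subseteq> V.
       if ind_path R q then card {v \<in> V. leg R q v} choose (k - (l + 2)) else 0)"
    using finQ' by (intro sum.mono_neutral_cong_left) (auto simp: Q_def)
  finally show ?thesis unfolding V_def .
qed

section \<open>Weakest preconditions with running time\<close>

definition wp :: "nat \<Rightarrow> com \<Rightarrow> (nat \<Rightarrow> ram_state \<Rightarrow> bool) \<Rightarrow> ram_state \<Rightarrow> bool" where
  "wp w c Q s \<longleftrightarrow> (\<exists>t s'. exec w c s t s' \<and> Q t s')"

lemma wp_mono: "wp w c P s \<Longrightarrow> (\<And>t s'. P t s' \<Longrightarrow> Q t s') \<Longrightarrow> wp w c Q s"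
  unfolding wp_def by blast

inductive_cases exec_NopE: "exec w Nop s t s'"
inductive_cases exec_SetConstE: "exec w (SetConst r c) s t s'"
inductive_cases exec_ArithE: "exec w (Arith f r a b) s t s'"
inductive_cases exec_LoadE: "exec w (Load r a) s t s'"
inductive_cases exec_StoreE: "exec w (Store r a) s t s'"
inductive_cases exec_SeqE: "exec w (Seq c1 c2) s t s'"
inductive_cases exec_IteE: "exec w (Ite e c1 c2) s t s'"

lemma wp_basic [simp]:
  "wp w Nop Q s \<longleftrightarrow> Q 1 s"
  "wp w (SetConst r c) Q s \<longleftrightarrow> Q 1 (set_reg r (c mod 2 ^ w) s)"
  "wp w (Arith f r a b) Q s \<longleftrightarrow> Q 1 (set_reg r (word_arith w f (regs s a) (regs s b)) s)"
  "wp w (Load r a) Q s \<longleftrightarrow> Q 1 (set_reg r (mem s (regs s a)) s)"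
  "wp w (Store a r) Q s \<longleftrightarrow> Q 1 (s\<lparr>mem := (mem s)(regs s a := regs s r)\<rparr>)"
  unfolding wp_def
  by (auto elim!: exec_NopE exec_SetConstE exec_ArithE exec_LoadE exec_StoreE)
    (metis One_nat_def exec.Nop exec.SetConst exec.Arith exec.Load exec.Store)+

lemma wp_Seq [simp]:
  "wp w (Seq c1 c2) Q s \<longleftrightarrow> wp w c1 (\<lambda>t1 s1. wp w c2 (\<lambda>t2 s2. Q (t1 + t2) s2) s1) s"
  unfolding wp_def by (blast intro: exec.Seq elim: exec_SeqE)

lemma wp_Ite [simp]:
  "wp w (Ite e c1 c2) Q s \<longleftrightarrow>
     (if holds e s then wp w c1 (\<lambda>t. Q (t + 1)) s else wp w c2 (\<lambda>t. Q (t + 1)) s)"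
  unfolding wp_def
  by (auto elim!: exec_IteE) (metis Suc_eq_plus1 exec.IteTrue, metis Suc_eq_plus1 exec.IteFalse)

text \<open>The invariant is indexed by the number of completed rounds. Each round pays one unit for
  its test; the last \<open>+ 1\<close> is the failing test.\<close>

lemma wp_Loop:
  assumes "I 0 s"
    and step: "\<And>i s. i < N \<Longrightarrow> I i s \<Longrightarrow> holds e s \<and> wp w c (\<lambda>t s'. t \<le> T \<and> I (Suc i) s') s"
    and stop: "\<And>s. I N s \<Longrightarrow> \<not> holds e s"
  shows "wp w (Loop e c) (\<lambda>t s'. t \<le> N * (T + 1) + 1 \<and> I N s') s"
proof -
  have "I i s \<Longrightarrow> \<exists>t s'. exec w (Loop e c) s t s' \<and> t \<le> (N - i) * (T + 1) + 1 \<and> I N s'"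
    if "i \<le> N" for i s
    using that
  proof (induction arbitrary: s rule: inc_induct)
    case base
    with stop show ?case by (fastforce intro: exec.LoopFalse)
  next
    case (step i)
    then obtain t1 s1 where 1: "holds e s" "exec w c s t1 s1" "t1 \<le> T" "I (Suc i) s1"
      using assms(2) unfolding wp_def by blast
    with step.IH obtain t2 s2 where
      2: "exec w (Loop e c) s1 t2 s2" "t2 \<le> (N - Suc i) * (T + 1) + 1" "I N s2" by blast
    have "N - i = Suc (N - Suc i)" using step.hyps by simp
    then have "t1 + t2 + 1 \<le> (N - i) * (T + 1) + 1" using 1(3) 2(2) by simp
    with 1 2 show ?case by (blast intro: exec.LoopTrue)
  qed
  from this[of 0 s] assms(1) show ?thesis unfolding wp_def by auto
qed

primrec block :: "com list \<Rightarrow> com" where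
  "block [] = Nop"
| "block (c # cs) = Seq c (block cs)"

lemma wp_block [simp]:
  "wp w (block []) Q s \<longleftrightarrow> Q 1 s"
  "wp w (block (c # cs)) Q s \<longleftrightarrow>
     wp w c (\<lambda>t1 s1. wp w (block cs) (\<lambda>t2 s2. Q (t1 + t2) s2) s1) s"
  by simp_all

text \<open>Keeps the simplifier from working on a continuation before its initial state is known.\<close>

lemma wp_cong [cong]: "s = s' \<Longrightarrow> wp w c Q s \<longleftrightarrow> wp w c Q s'"
  by simp

declare word_arith.simps [simp del]

lemma word_arith_exact [simp]:
  "x + y < 2 ^ w \<Longrightarrow> word_arith w Plus x y = x + y"
  "y \<le> x \<Longrightarrow> x < 2 ^ w \<Longrightarrow> word_arith w Minus x y = x - y"
  "x * y < 2 ^ w \<Longrightarrow> word_arith w Times x y = x * y"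
proof -
  assume *: "y \<le> x" "x < 2 ^ w"
  have "(int x - int y) mod 2 ^ w = int (x - y)"
    using * by (subst mod_pos_pos_trivial) (auto simp flip: of_nat_diff)
  then show "word_arith w Minus x y = x - y" by (simp add: word_arith.simps)
qed (simp_all add: word_arith.simps)

section \<open>Multi-word numbers in the base of \<open>has_output\<close>, and their
  addition\<close>

definition bval :: "nat \<Rightarrow> nat \<Rightarrow> (nat \<Rightarrow> nat) \<Rightarrow> nat \<Rightarrow> nat" where
  "bval w n m a = (\<Sum>i < n. m (a + i) * (2 ^ w) ^ i)"

lemma bval_Suc: "bval w (Suc n) m a = bval w n m a + m (a + n) * (2 ^ w) ^ n"
  by (simp add: bval_def)

lemma bval_cong: "(\<And>i. i < n \<Longrightarrow> m (a + i) = m' (a + i)) \<Longrightarrow> bval w n m a = bval w n m' a"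
  unfolding bval_def by (intro sum.cong) auto

text \<open>
  Register layout, with \<open>L = l + 2\<close> and \<open>W = n + 1\<close>:
  \<open>3\<close>, \<open>4\<close>: the constants 0 and 1; \<open>5\<close>: \<open>L\<close>; \<open>6\<close>: address of the current tuple;
  \<open>7\<close>: address of the accumulated count; \<open>8\<close>: address of \<open>0 choose (k - L)\<close>;
  \<open>9\<close>: \<open>W * n\<close>, the distance of the rows of Pascal's triangle; \<open>10\<close>: carry of the odometer;
  \<open>11\<close>, \<open>12\<close>: addresses of source and destination of an addition;
  \<open>13\<close>, \<open>14\<close>, \<open>15\<close>: the vertex, the position and the result of \<open>match_prog\<close>.
  Registers from \<open>20\<close> on are scratch.  In memory, the adjacency matrix is followed by \<open>n\<close> zeros,
  Pascal's triangle, the accumulated count and the tuple.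
\<close>

definition add_body :: com where
  "add_body = block
    [Arith Plus 22 11 20, Load 23 22, Arith Plus 22 12 20, Load 24 22,
     Arith Plus 24 24 23, Arith Plus 25 24 21, Store 22 25,
     Ite (Less 24 23) (SetConst 21 1) (Ite (Less 25 24) (SetConst 21 1) (SetConst 21 0)),
     Arith Plus 20 20 4]"

definition add_prog :: com where
  "add_prog = block [SetConst 20 0, SetConst 21 0, Loop (Less 20 0) add_body]"

text \<open>A sum modulo \<open>B\<close> has wrapped iff it is smaller than a summand. As
  \<open>x + y + c < 2 * B\<close>, at most one of the two additions wraps, so a single carry bit
  suffices.\<close>

lemma carry_step:
  fixes x y c B :: nat
  assumes "x < B" "y < B" "c \<le> 1" "1 < B"
  defines "z1 \<equiv> (y + x) mod B"
  defines "z2 \<equiv> (z1 + c) mod B"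
  shows "z2 + (if z1 < x \<or> z2 < z1 then 1 else 0) * B = x + y + c"
proof -
  have 1: "z1 = (if y + x < B then y + x else y + x - B)"
    using assms by (auto simp: mod_if)
  have 2: "z2 = (if z1 + c < B then z1 + c else z1 + c - B)"
    using assms by (auto simp: mod_if)
  show ?thesis using assms(1-4) unfolding 2 by (auto simp: 1)
qed

lemma add_spec:
  assumes regs: "regs s 0 = n" "regs s 4 = 1" "regs s 11 = S" "regs s 12 = D"
    and addr: "S + n \<le> D" "D + n \<le> 2 ^ w" and n: "n < 2 ^ w" and w: "0 < w"
    and words: "\<And>i. i < n \<Longrightarrow> mem s (S + i) < 2 ^ w" "\<And>i. i < n \<Longrightarrow> mem s (D + i) < 2 ^ w"
    and fits: "bval w n (mem s) S + bval w n (mem s) D < (2 ^ w) ^ n"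
  shows "wp w add_prog (\<lambda>t s'. t \<le> 20 * n + 10 \<and> (\<forall>r < 20. regs s' r = regs s r) \<and>
    (\<forall>a. a < D \<or> D + n \<le> a \<longrightarrow> mem s' a = mem s a) \<and> (\<forall>i < n. mem s' (D + i) < 2 ^ w) \<and>
    bval w n (mem s') D = bval w n (mem s) S + bval w n (mem s) D) s"
proof -
  have one: "1 < (2 :: nat) ^ w" using w by (intro one_less_power) auto
  \<comment> \<open>The carry in register 21 has the weight \<open>(2 ^ w) ^ i\<close> of the next
    digit.\<close>
  define I where "I i s' \<longleftrightarrow> regs s' 20 = i \<and> regs s' 21 \<le> 1 \<and> (\<forall>r < 20. regs s' r = regs s r) \<and>
    (\<forall>a. a < D \<or> D + i \<le> a \<longrightarrow> mem s' a = mem s a) \<and> (\<forall>j < i. mem s' (D + j) < 2 ^ w) \<and>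
    bval w i (mem s') D + regs s' 21 * (2 ^ w) ^ i = bval w i (mem s) S + bval w i (mem s) D"
    for i and s' :: ram_state
  have step: "holds (Less 20 0) s' \<and> wp w add_body (\<lambda>t s'. t \<le> 18 \<and> I (Suc i) s') s'"
    if i: "i < n" and I: "I i s'" for i s'
  proof -
    define x y c where xyc: "x = mem s (S + i)" "y = mem s (D + i)" "c = regs s' 21"
    define z1 where "z1 = (y + x) mod 2 ^ w"
    define z2 where "z2 = (z1 + c) mod 2 ^ w"
    define c' :: nat where "c' = (if z1 < x \<or> z2 < z1 then 1 else 0)"
    have "z2 + c' * 2 ^ w = x + y + c"
      using carry_step[of x "2 ^ w" y c] words i I one
      unfolding c'_def z1_def z2_def xyc I_def by simp
    from arg_cong[OF this, of "\<lambda>u. u * (2 ^ w) ^ i"]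
    have carry: "z2 * (2 ^ w) ^ i + c' * (2 ^ w * (2 ^ w) ^ i) = 
        x * (2 ^ w) ^ i + y * (2 ^ w) ^ i + c * (2 ^ w) ^ i"
      by (simp add: algebra_simps)
    have r: "regs s' 20 = i" "regs s' 21 = c" "c \<le> 1" "regs s' 0 = n" "regs s' 4 = 1"
      "regs s' 11 = S" "regs s' 12 = D" "mem s' (S + i) = x" "mem s' (D + i) = y"
      using I regs i addr unfolding I_def xyc by auto
    have plus: "word_arith w Plus y x = z1" "word_arith w Plus z1 c = z2"
      by (simp_all add: word_arith.simps z1_def z2_def)
    have z2: "z2 < 2 ^ w" unfolding z2_def by simp
    have new: "I (Suc i) s''"
      if "regs s'' 20 = Suc i" "regs s'' 21 = c'" "\<forall>r < 20. regs s'' r = regs s' r"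
        "mem s'' = (mem s')(D + i := z2)" for s''
    proof -
      have "bval w i (mem s'') D = bval w i (mem s') D"
        unfolding that by (rule bval_cong) auto
      moreover have "c' \<le> 1" by (simp add: c'_def)
      ultimately show ?thesis
        using I carry z2 unfolding I_def that bval_Suc xyc[symmetric]
        by (auto simp: that(3) less_Suc_eq xyc(3))
    qed
    have "wp w add_body (\<lambda>t s'. t \<le> 18 \<and> I (Suc i) s') s'"
      unfolding add_body_def
      using i addr n one by (simp add: r plus, intro conjI impI new) (auto simp: r c'_def)
    then show ?thesis using r i by simp
  qed
  have loop: "wp w (Loop (Less 20 0) add_body) (\<lambda>t s'. t \<le> n * (18 + 1) + 1 \<and> I n s') s1"
    if "I 0 s1" for s1
    using step by (rule wp_Loop[where I = I, OF that]) (auto simp: I_def regs)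
  show ?thesis unfolding add_prog_def
    apply simp
    apply (rule wp_mono[OF loop])
    subgoal by (auto simp: I_def bval_def)
    \<comment> \<open>A final carry would contribute \<open>(2 ^ w) ^ n\<close>, contradicting
      \<open>fits\<close>.\<close>
    subgoal for t s'
      using fits unfolding I_def by (cases "regs s' 21") auto
    done
qed

section \<open>Enumerating and testing tuples\<close>

text \<open>Register 24 is the adjacency bit that \<open>matches\<close> demands, register 23 the
  one found in the matrix. Register 15 is only ever cleared, so one flag collects the verdicts of
  all calls in \<open>path_prog\<close>.\<close>

definition match_body :: com where
  "match_body = block
    [Arith Plus 22 6 20, Load 21 22, Arith Times 22 21 0, Arith Plus 22 22 13, Load 23 22,
     Arith Plus 25 20 4, Arith Plus 26 25 4, SetConst 24 0,
     Ite (Eq 14 20) (SetConst 24 1) Nop,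
     Ite (Eq 14 26) (SetConst 24 1) Nop,
     Ite (Eq 23 24) Nop (SetConst 15 0),
     Ite (Eq 21 13) (Ite (Eq 14 25) Nop (SetConst 15 0)) Nop,
     Arith Plus 20 20 4]"

definition match_prog :: com where
  "match_prog = block [SetConst 20 0, Loop (Less 20 5) match_body]"

definition path_body :: com where
  "path_body = block [Arith Plus 13 6 14, Load 13 13, Arith Plus 14 14 4, match_prog]"

definition path_prog :: com where
  "path_prog = block [SetConst 15 1, SetConst 14 0, Loop (Less 14 5) path_body]"

definition legs_body :: com where
  "legs_body = block
    [SetConst 15 1, match_prog, Ite (Eq 15 4) (Arith Plus 11 11 9) Nop, Arith Plus 13 13 4]"

text \<open>Register 11 descends one row of Pascal's triangle for each leg found. It thus ends at
  the address of the required binomial coefficient, without a separate count of the legs.\<close>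

definition legs_prog :: com where
  "legs_prog = block [Arith Plus 11 8 3, SetConst 13 0, SetConst 14 0, Loop (Less 13 0) legs_body]"

definition incr_body :: com where
  "incr_body = block
    [Arith Plus 21 6 20, Load 22 21, Arith Plus 22 22 10,
     Ite (Eq 22 0) (block [SetConst 10 1, SetConst 22 0]) (SetConst 10 0),
     Store 21 22, Arith Plus 20 20 4]"

definition incr_prog :: com where
  "incr_prog = block [SetConst 10 1, SetConst 20 0, Loop (Less 20 5) incr_body]"

lemma matrix_index_less:
  assumes "u < n" "v < n"
  shows "u * n + v < n * (n :: nat)"
proof -
  have "u * n + v < (u + 1) * n" using assms by simp
  also have "\<dots> \<le> n * n" using assms by (intro mult_right_mono) auto
  finally show ?thesis .
qed

text \<open>Used with \<open>y = x div n ^ i\<close> and the incoming carry \<open>c\<close>; as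
  \<open>c \<le> 1\<close>, a digit overflows only by reaching exactly \<open>n\<close>.\<close>

lemma incr_digit:
  fixes n y c :: nat
  assumes "0 < n" "c \<le> 1"
  shows "y mod n + c = n \<Longrightarrow> (y + c) mod n = 0 \<and> (y + c) div n = y div n + 1"
    and "y mod n + c \<noteq> n \<Longrightarrow> (y + c) mod n = y mod n + c \<and> (y + c) div n = y div n"
proof -
  define a b where ab: "a = y div n" "b = y mod n"
  have y: "y + c = (b + c) + n * a" unfolding ab by simp
  show "(y + c) mod n = 0 \<and> (y + c) div n = y div n + 1" if "y mod n + c = n"
    unfolding y that[folded ab] using assms by (simp add: ab)
  assume "y mod n + c \<noteq> n"
  moreover have "y mod n < n" using assms by simp
  ultimately have "b + c < n" using assms unfolding ab by linarith
  then show "(y + c) mod n = y mod n + c \<and> (y + c) div n = y div n"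
    unfolding y ab[symmetric] by simp
qed

definition digits :: "nat \<Rightarrow> nat \<Rightarrow> nat \<Rightarrow> nat list" where
  "digits n L x = map (\<lambda>i. x div n ^ i mod n) [0..<L]"

text \<open>Injectivity goes by induction on the number of digits; surjectivity then follows as both
  sets have \<open>n ^ L\<close> elements.\<close>

lemma bij_betw_digits:
  assumes "0 < n"
  shows "bij_betw (digits n L) {..<n ^ L} {q. length q = L \<and> set q \<subseteq> {..<n}}"
proof -
  have inj: "x = y" if "x < n ^ L" "y < n ^ L" "\<forall>i < L. x div n ^ i mod n = y div n ^ i mod n" for x y
    using that
  proof (induction L arbitrary: x y)
    case (Suc L)
    have "x div n = y div n"
    proof (rule Suc.IH)
      show "x div n < n ^ L" "y div n < n ^ L"
        using Suc.prems assms by (auto simp: less_mult_imp_div_less mult.commute)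
      show "\<forall>i < L. x div n div n ^ i mod n = y div n div n ^ i mod n"
        using Suc.prems(3) by (auto simp: div_mult2_eq[symmetric] dest: spec[of _ "Suc _"])
    qed
    moreover have "x mod n = y mod n" using Suc.prems(3)[rule_format, of 0] by simp
    ultimately show ?case by (metis div_mult_mod_eq)
  qed auto
  have "inj_on (digits n L) {..<n ^ L}"
    by (rule inj_onI, rule inj) (auto simp: digits_def)
  moreover have "digits n L ` {..<n ^ L} \<subseteq> {q. length q = L \<and> set q \<subseteq> {..<n}}"
    using assms by (auto simp: digits_def)
  moreover have "card {q. length q = L \<and> set q \<subseteq> {..<n}} = n ^ L"
    and "finite {q. length q = L \<and> set q \<subseteq> {..<n}}"
    using card_lists_length_eq[of "{..<n}" L] finite_lists_length_eq[of "{..<n}" L]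
    by (simp_all add: conj_commute)
  ultimately have "digits n L ` {..<n ^ L} = {q. length q = L \<and> set q \<subseteq> {..<n}}"
    by (intro card_subset_eq) (simp_all add: card_image)
  with \<open>inj_on (digits n L) {..<n ^ L}\<close> show ?thesis unfolding bij_betw_def by simp
qed

text \<open>\<open>A\<close> is the address of the tuple, behind the matrix. The bound on
  \<open>L + 2\<close> leaves room for the values \<open>i + 2\<close> in
  \<open>match_body\<close>.\<close>

locale odometer =
  fixes w n L A :: nat and R :: "nat \<Rightarrow> nat \<Rightarrow> bool"
  assumes n: "n < 2 ^ w" "n * n \<le> A" and A: "A + L < 2 ^ w" "L + 2 < 2 ^ w" and w: "0 < w"
begin

definition ready :: "nat list \<Rightarrow> ram_state \<Rightarrow> bool" where
  "ready q s \<longleftrightarrow> regs s 0 = n \<and> regs s 3 = 0 \<and> regs s 4 = 1 \<and> regs s 5 = L \<and> regs s 6 = A \<and>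
     length q = L \<and> set q \<subseteq> {..<n} \<and> (\<forall>i < L. mem s (A + i) = q ! i) \<and>
     (\<forall>u < n. \<forall>v < n. mem s (u * n + v) = of_bool (R u v))"

lemma ready_cong:
  assumes "ready q s" "\<forall>r < 7. regs s' r = regs s r" "mem s' = mem s"
  shows "ready q s'"
  using assms unfolding ready_def by auto

lemma match_spec:
  assumes s: "ready q s" and v: "regs s 13 = v" "v < n" and p: "regs s 14 = p"
  shows "wp w match_prog (\<lambda>t s'. t \<le> 25 * L + 10 \<and> mem s' = mem s \<and>
    (\<forall>r < 20. r \<noteq> 15 \<longrightarrow> regs s' r = regs s r) \<and>
    regs s' 15 = (if matches R q p v then regs s 15 else 0)) s"
proof -
  define P where "P i \<longleftrightarrow> (R (q ! i) v \<longleftrightarrow> i = p \<or> i + 2 = p) \<and> (q ! i = v \<longrightarrow> i + 1 = p)" for i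
  define I where "I i s' \<longleftrightarrow> regs s' 20 = i \<and> mem s' = mem s \<and>
    (\<forall>r < 20. r \<noteq> 15 \<longrightarrow> regs s' r = regs s r) \<and>
    regs s' 15 = (if \<forall>j < i. P j then regs s 15 else 0)" for i and s' :: ram_state
  have step: "holds (Less 20 5) s' \<and> wp w match_body (\<lambda>t s'. t \<le> 22 \<and> I (Suc i) s') s'"
    if i: "i < L" and I: "I i s'" for i s'
  proof -
    define u where "u = q ! i"
    have u: "u < n" using s i unfolding u_def ready_def by (auto simp: subset_iff)
    have a: "u * n + v < 2 ^ w" using matrix_index_less[OF u v(2)] n A by simp
    have r: "regs s' 0 = n" "regs s' 4 = 1" "regs s' 5 = L" "regs s' 6 = A" "regs s' 20 = i"
      "regs s' 13 = v" "regs s' 14 = p" "mem s' (A + i) = u" "mem s' (u * n + v) = of_bool (R u v)"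
      using I s i v p u unfolding I_def ready_def u_def by auto
    have new: "I (Suc i) s''"
      if "regs s'' 20 = Suc i" "regs s'' 15 = (if P i then regs s' 15 else 0)"
        "\<forall>r < 20. r \<noteq> 15 \<longrightarrow> regs s'' r = regs s' r" "mem s'' = mem s'" for s''
      using I that unfolding I_def by (auto simp: less_Suc_eq)
    have "wp w match_body (\<lambda>t s'. t \<le> 22 \<and> I (Suc i) s') s'"
      unfolding match_body_def using i A a w
      by (simp add: r) (auto simp: P_def u_def[symmetric] r intro!: new)
    then show ?thesis using r i by simp
  qed
  have loop: "wp w (Loop (Less 20 5) match_body) (\<lambda>t s'. t \<le> L * (22 + 1) + 1 \<and> I L s') s1"
    if "I 0 s1" for s1
    using step by (rule wp_Loop[where I = I, OF that]) (use s in \<open>auto simp: I_def ready_def\<close>)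
  have P: "(\<forall>j < L. P j) \<longleftrightarrow> matches R q p v"
    using s unfolding P_def matches_def ready_def by simp
  show ?thesis unfolding match_prog_def
    by (simp split del: if_split) (rule wp_mono[OF loop], auto simp: I_def P)
qed

lemma path_spec:
  assumes s: "ready q s"
  shows "wp w path_prog (\<lambda>t s'. t \<le> L * (25 * L + 20) + 10 \<and> mem s' = mem s \<and>
    (\<forall>r < 13. regs s' r = regs s r) \<and> regs s' 15 = of_bool (ind_path R q)) s"
proof -
  define I where "I i s' \<longleftrightarrow> regs s' 14 = i \<and> mem s' = mem s \<and> (\<forall>r < 13. regs s' r = regs s r) \<and>
    regs s' 15 = of_bool (\<forall>j < i. matches R q (j + 1) (q ! j))" for i and s' :: ram_state
  have step: "holds (Less 14 5) s' \<and> wp w path_body (\<lambda>t s'. t \<le> 25 * L + 16 \<and> I (Suc i) s') s'"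
    if i: "i < L" and I: "I i s'" for i s'
  proof -
    have r: "regs s' 4 = 1" "regs s' 5 = L" "regs s' 6 = A" "regs s' 14 = i" "mem s' (A + i) = q ! i"
      using I s i unfolding I_def ready_def by auto
    have v: "q ! i < n" using s i unfolding ready_def by (auto simp: subset_iff)
    have "wp w path_body (\<lambda>t s'. t \<le> 25 * L + 16 \<and> I (Suc i) s') s'"
      unfolding path_body_def using i A
      apply (simp add: r)
      apply (rule wp_mono[OF match_spec[of q _ "q ! i" "Suc i"]])
      subgoal using s I by (elim ready_cong) (auto simp: I_def)
      subgoal by simp
      subgoal by (rule v)
      subgoal by simp
      subgoal using I unfolding I_def by (auto simp: less_Suc_eq)
      done
    then show ?thesis using r i by simp
  qed
  have loop: "wp w (Loop (Less 14 5) path_body)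
      (\<lambda>t s'. t \<le> L * (25 * L + 16 + 1) + 1 \<and> I L s') s1"
    if "I 0 s1" for s1
    using step by (rule wp_Loop[where I = I, OF that]) (use s in \<open>auto simp: I_def ready_def\<close>)
  have P: "(\<forall>j < L. matches R q (Suc j) (q ! j)) \<longleftrightarrow> ind_path R q"
    using s unfolding ind_path_def ready_def by simp
  show ?thesis unfolding path_prog_def using w
    by (simp split del: split_of_bool) (rule wp_mono[OF loop], auto simp: I_def P algebra_simps)
qed

lemma legs_spec:
  assumes s: "ready q s" and fits: "regs s 8 + n * regs s 9 < 2 ^ w"
  shows "wp w legs_prog (\<lambda>t s'. t \<le> n * (25 * L + 25) + 10 \<and> mem s' = mem s \<and>
    (\<forall>r < 13. r \<noteq> 11 \<longrightarrow> regs s' r = regs s r) \<and>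
    regs s' 11 = regs s 8 + card {v \<in> {..<n}. leg R q v} * regs s 9) s"
proof -
  define m where "m i = card {v \<in> {..<i}. leg R q v}" for i
  have m_Suc: "m (Suc i) = (if leg R q i then Suc (m i) else m i)" for i
  proof -
    have "{v \<in> {..<Suc i}. leg R q v} =
      (if leg R q i then insert i {v \<in> {..<i}. leg R q v} else {v \<in> {..<i}. leg R q v})"
      by (auto simp: less_Suc_eq)
    then show ?thesis by (simp add: m_def)
  qed
  have m_le: "m i \<le> i" for i
    unfolding m_def using card_mono[of "{..<i}" "{v \<in> {..<i}. leg R q v}"] by fastforce
  define I where "I i s' \<longleftrightarrow> regs s' 13 = i \<and> regs s' 14 = 0 \<and> mem s' = mem s \<and>
    (\<forall>r < 13. r \<noteq> 11 \<longrightarrow> regs s' r = regs s r) \<and> regs s' 11 = regs s 8 + m i * regs s 9"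
    for i and s' :: ram_state
  have step: "holds (Less 13 0) s' \<and> wp w legs_body (\<lambda>t s'. t \<le> 25 * L + 20 \<and> I (Suc i) s') s'"
    if i: "i < n" and I: "I i s'" for i s'
  proof -
    have r: "regs s' 0 = n" "regs s' 4 = 1" "regs s' 13 = i"
      using I s i unfolding I_def ready_def by auto
    have "m i + 1 \<le> n" using m_le[of i] i by simp
    then have "(m i + 1) * regs s 9 \<le> n * regs s 9" by (rule mult_right_mono) simp
    then have fit: "regs s 8 + m i * regs s 9 + regs s 9 < 2 ^ w" using fits by simp
    have "wp w legs_body (\<lambda>t s'. t \<le> 25 * L + 20 \<and> I (Suc i) s') s'"
      unfolding legs_body_def
      apply (simp add: w)
      apply (rule wp_mono[OF match_spec[of q _ i 0]])
      subgoal using s I by (elim ready_cong) (auto simp: I_def)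
      subgoal using I by (simp add: I_def)
      subgoal by (rule i)
      subgoal using I by (simp add: I_def)
      subgoal using I fit i n r unfolding I_def by (auto simp: m_Suc)
      done
    then show ?thesis using r i by simp
  qed
  have loop: "wp w (Loop (Less 13 0) legs_body)
      (\<lambda>t s'. t \<le> n * (25 * L + 20 + 1) + 1 \<and> I n s') s1"
    if "I 0 s1" for s1
    using step by (rule wp_Loop[where I = I, OF that]) (use s in \<open>auto simp: I_def ready_def\<close>)
  have "regs s 3 = 0" "regs s 8 < 2 ^ w" "m 0 = 0" using s fits by (auto simp: ready_def m_def)
  then show ?thesis unfolding legs_prog_def m_def[symmetric]
    by simp (rule wp_mono[OF loop], auto simp: I_def algebra_simps)
qed

lemma incr_spec:
  assumes s: "ready (digits n L x) s" and x: "x < n ^ L"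
  shows "wp w incr_prog (\<lambda>t s'. t \<le> 20 * L + 10 \<and> ready (digits n L (Suc x)) s' \<and>
    (\<forall>a < A. mem s' a = mem s a) \<and> (\<forall>r < 20. r \<noteq> 10 \<longrightarrow> regs s' r = regs s r) \<and>
    regs s' 10 = Suc x div n ^ L) s"
proof -
  have n0: "0 < n" if "0 < L" using x that by (cases "n = 0") (auto simp: power_0_left)
  \<comment> \<open>The carry into position \<open>i\<close> is what the increment adds to
    \<open>x div n ^ i\<close>.\<close>
  define I where "I i s' \<longleftrightarrow> regs s' 20 = i \<and> regs s' 10 \<le> 1 \<and>
    x div n ^ i + regs s' 10 = Suc x div n ^ i \<and>
    (\<forall>r < 20. r \<noteq> 10 \<longrightarrow> regs s' r = regs s r) \<and> (\<forall>a < A. mem s' a = mem s a) \<and>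
    (\<forall>j < L. mem s' (A + j) = (if j < i then Suc x else x) div n ^ j mod n)"
    for i and s' :: ram_state
  have step: "holds (Less 20 5) s' \<and> wp w incr_body (\<lambda>t s'. t \<le> 16 \<and> I (Suc i) s') s'"
    if i: "i < L" and I: "I i s'" for i s'
  proof -
    define y c where yc: "y = x div n ^ i" "c = regs s' 10"
    have r: "regs s' 0 = n" "regs s' 4 = 1" "regs s' 5 = L" "regs s' 6 = A" "regs s' 20 = i"
      "regs s' 10 = c" "mem s' (A + i) = y mod n" "c \<le> 1"
      using I s i unfolding I_def ready_def yc by auto
    have y': "Suc x div n ^ i = y + c" using I unfolding I_def yc by simp
    have div_Suc: "z div (n * n ^ i) = z div n ^ i div n" for z
      by (simp add: div_mult2_eq[symmetric] mult.commute)
    have "0 < n" using n0 i by simp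
    note d = incr_digit[OF this r(8), of y]
    have "y mod n < n" using \<open>0 < n\<close> by simp
    then have fit: "y mod n + c < 2 ^ w" if "n < 2 ^ w" using that \<open>c \<le> 1\<close> by linarith
    have new: "I (Suc i) s''"
      if "regs s'' 20 = Suc i" "regs s'' 10 = (if y mod n + c = n then 1 else 0)"
        "\<forall>r < 20. r \<noteq> 10 \<longrightarrow> regs s'' r = regs s' r"
        "mem s'' = (mem s')(A + i := if y mod n + c = n then 0 else y mod n + c)" for s''
      unfolding I_def that(1,2,4) using I that(3) d y'
      by (auto simp: I_def less_Suc_eq div_Suc yc(1)[symmetric])
    have "wp w incr_body (\<lambda>t s'. t \<le> 16 \<and> I (Suc i) s') s'"
      unfolding incr_body_def using i A n fit w
      by (simp add: r, intro conjI impI new) (auto simp: r)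
    then show ?thesis using r i by simp
  qed
  have loop: "wp w (Loop (Less 20 5) incr_body) (\<lambda>t s'. t \<le> L * (16 + 1) + 1 \<and> I L s') s1"
    if "I 0 s1" for s1
    using step by (rule wp_Loop[where I = I, OF that]) (use s in \<open>auto simp: I_def ready_def\<close>)
  have fin: "ready (digits n L (Suc x)) s'" if "I L s'" for s'
  proof -
    have "u * n + v < A" if "u < n" "v < n" for u v
      using matrix_index_less[OF that] n by simp
    moreover have "set (digits n L (Suc x)) \<subseteq> {..<n}"
      using n0 by (auto simp: digits_def)
    ultimately show ?thesis
      using that s unfolding ready_def I_def by (auto simp: digits_def)
  qed
  show ?thesis unfolding incr_prog_def
    apply (simp add: w)
    apply (rule wp_mono[OF loop])
    subgoal using s by (auto simp: I_def ready_def digits_def)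
    subgoal for t s' using fin[of s'] x by (auto simp: I_def)
    done
qed

end

section \<open>Summation of binomial coefficients\<close>

text \<open>The entry at register 12 is still zero. The entry above it and the left neighbour of
  that one are added to it in place.\<close>

definition pascal_body :: com where
  "pascal_body = block
    [Arith Minus 11 12 9, add_prog, Arith Minus 11 11 0, add_prog, Arith Plus 12 12 0]"

definition pascal_prog :: com where
  "pascal_prog = Loop (Less 12 7) pascal_body"

text \<open>\<open>add_prog\<close> adds into the address in register 12: \<open>pascal_prog\<close>
  stops when it equals register 7, the address of the accumulated count.\<close>

definition tuple_body :: com where
  "tuple_body = block
    [path_prog, Ite (Eq 15 4) (block [legs_prog, add_prog]) Nop, incr_prog]"

text \<open>The carry out of the last digit is the stop signal: it appears when the final tuple
  wraps around to zero.\<close>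

definition tuples_prog :: com where
  "tuples_prog = Loop (Eq 10 3) tuple_body"

definition init_prog :: com where
  "init_prog = block
    [SetConst 4 1, SetConst 17 2, Arith Plus 5 1 17,
     Arith Times 16 0 0, Arith Plus 16 16 0, Store 16 4,
     Arith Plus 17 0 4, Arith Times 9 17 0, Arith Times 18 17 9, Arith Plus 7 16 18,
     Arith Plus 6 7 0, Arith Minus 18 2 5, Arith Times 18 18 0, Arith Plus 8 16 18,
     Arith Plus 12 16 9]"

text \<open>For \<open>n < k\<close> the answer 0 is the number without digits. Otherwise register 0
  still contains \<open>n\<close>, which is also the number of output digits.\<close>

definition scorpion_prog :: com where
  "scorpion_prog = Ite (Less 0 2) (SetConst 0 0)
     (block [init_prog, pascal_prog, tuples_prog, Arith Plus 1 7 3])"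

text \<open>With \<open>w = 1\<close> the base would be 2 and \<open>2 ^ n\<close> itself would need
  one more digit.\<close>

lemma le_two_power_fits:
  assumes "x \<le> 2 ^ n" "0 < n" "2 \<le> w"
  shows "x < ((2 :: nat) ^ w) ^ n"
proof -
  have "(2 :: nat) ^ 1 < 2 ^ w" using assms by (intro power_strict_increasing) auto
  then have "(2 :: nat) ^ n < (2 ^ w) ^ n" using assms by (intro power_strict_mono) auto
  with assms show ?thesis by linarith
qed

text \<open>In the row-by-row list of the binomial coefficients \<open>m choose j\<close> with \<open>m, j \<le> n\<close>, the left
  neighbour of an entry in column \<open>0\<close> is an entry \<open>(m - 2) choose n = 0\<close>, so that Pascal's rule
  needs no case distinction.\<close>

lemma flat_pascal:
  assumes W: "W = n + 1" and i: "i < n * W"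
  shows "((W + i) div W choose ((W + i) mod W)) =
    (i div W choose (i mod W)) + (if i = 0 then 0 else (i - 1) div W choose ((i - 1) mod W))"
proof -
  define m j where mj: "m = i div W" "j = i mod W"
  have W0: "0 < W" using W by simp
  have ij: "i = m * W + j" "j < W" "m < n" 
    using i W0 by (simp_all add: mj less_mult_imp_div_less)
  have "(W + i) div W = Suc m" "(W + i) mod W = j" using W0 by (simp_all add: mj)
  moreover have "(Suc m choose j) =
      (m choose j) + (if i = 0 then 0 else (i - 1) div W choose ((i - 1) mod W))"
  proof (cases j)
    case (Suc j')
    have "i - 1 = m * W + j'" using ij Suc by simp
    then have "(i - 1) div W = m" "(i - 1) mod W = j'" using ij Suc by simp_all
    then show ?thesis using ij Suc by simp
  next
    case 0
    show ?thesis
    proof (cases m)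
      case (Suc m')
      have "i - 1 = m' * W + n" using ij 0 Suc W by simp
      moreover have "n < W" using W by simp
      ultimately have "(i - 1) div W = m'" "(i - 1) mod W = n" by simp_all
      then show ?thesis using ij 0 Suc W by simp
    qed (use 0 ij in simp)
  qed
  ultimately show ?thesis by (simp add: mj)
qed

lemma pascal_spec:
  assumes regs: "regs s 0 = n" "regs s 4 = 1" "regs s 9 = W * n" "regs s 12 = T + W * n"
      "regs s 7 = T + W * W * n"
    and W: "W = n + 1" and n: "0 < n" "n \<le> T" and w: "2 \<le> w"
    and addr: "T + W * W * n + n < 2 ^ w"
    and mem: "mem s T = 1" "\<And>a. T \<le> a + n \<Longrightarrow> a \<noteq> T \<Longrightarrow> mem s a = 0"
  shows "wp w pascal_prog (\<lambda>t s'. t \<le> n * W * (40 * n + 30) + 1 \<and>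
    (\<forall>r < 11. regs s' r = regs s r) \<and> regs s' 12 = T + W * W * n \<and>
    (\<forall>a < T. mem s' a = mem s a) \<and> (\<forall>a \<ge> T + W * W * n. mem s' a = 0) \<and>
    (\<forall>i < W * W. (\<forall>j < n. mem s' (T + i * n + j) < 2 ^ w) \<and>
      bval w n (mem s') (T + i * n) = (i div W choose (i mod W)))) s"
proof -
  define F where "F i = (i div W choose (i mod W))" for i
  have F_le: "F i \<le> 2 ^ n" if "i < W * W" for i
  proof -
    have "i div W < W" using that by (simp add: less_mult_imp_div_less)
    then have "i div W \<le> n" using W by simp
    then have "(2 :: nat) ^ (i div W) \<le> 2 ^ n" by (intro power_increasing) auto
    then show ?thesis unfolding F_def using binomial_le_pow2 order_trans by blast
  qed
  have one: "(1 :: nat) < 2 ^ w" using w by (intro one_less_power) auto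
  \<comment> \<open>Row 0 is there from the start, so \<open>W + i\<close> entries are finished
    after \<open>i\<close> rounds, and \<open>n * W\<close> rounds complete all
    \<open>W * W\<close>.\<close>
  define I where "I i s' \<longleftrightarrow> (\<forall>r < 11. regs s' r = regs s r) \<and> regs s' 12 = T + (W + i) * n \<and>
    (\<forall>a < T. mem s' a = mem s a) \<and> (\<forall>a \<ge> T + (W + i) * n. mem s' a = 0) \<and>
    (\<forall>e < W + i. (\<forall>j < n. mem s' (T + e * n + j) < 2 ^ w) \<and> bval w n (mem s') (T + e * n) = F e)"
    for i and s' :: ram_state
  have step: "holds (Less 12 7) s' \<and> wp w pascal_body (\<lambda>t s'. t \<le> 40 * n + 29 \<and> I (Suc i) s') s'"
    if i: "i < n * W" and I: "I i s'" for i s'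
  proof -
    define D where "D = T + (W + i) * n"
    define S where "S = T + i * n"
    have WW: "W + i < W * W" using i W by simp
    have "(W + i) * n + n \<le> W * W * n"
      using mult_right_mono[of "W + i + 1" "W * W" n] WW by simp
    then have D: "D + n \<le> T + W * W * n" "D + n < 2 ^ w" unfolding D_def using addr by linarith+
    have DS: "D = S + W * n" "n \<le> S" unfolding D_def S_def using n by (simp_all add: algebra_simps)
    have "n \<le> W * n" using W by simp
    then have SD: "S + n \<le> D" unfolding DS by simp
    have r: "regs s' 0 = n" "regs s' 4 = 1" "regs s' 7 = T + W * W * n" "regs s' 9 = W * n"
      "regs s' 12 = D"
      using I regs unfolding I_def D_def by auto
    have zeroD: "mem s' (D + j) = 0" for j using I unfolding I_def D_def by simp
    have bD: "bval w n (mem s') D = 0" using zeroD by (simp add: bval_def)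
    have bS: "bval w n (mem s') S = F i" and wS: "\<forall>j < n. mem s' (S + j) < 2 ^ w"
      using I W unfolding I_def S_def by auto
    define G where "G = (if i = 0 then 0 else F (i - 1))"
    have FG: "F (W + i) = F i + G"
      using flat_pascal[OF W i] unfolding F_def G_def by simp
    have S': "bval w n (mem s') (S - n) = G \<and> (\<forall>j < n. mem s' (S - n + j) < 2 ^ w)"
    proof (cases "i = 0")
      \<comment> \<open>The \<open>n\<close> zeros in front of the triangle act as the left
        neighbour of its very first entry.\<close>
      case True
      have "mem s' (S - n + j) = 0" if "j < n" for j
      proof -
        have "S - n + j < T" using True that n unfolding S_def by simp
        moreover have "mem s (S - n + j) = 0"
          using True that n unfolding S_def by (intro mem) auto
        ultimately show ?thesis using I unfolding I_def by simp
      qed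
      then show ?thesis using True by (simp add: bval_def G_def)
    next
      case False
      have "i * n = (i - 1) * n + n" using False by (cases i) auto
      then have "S - n = T + (i - 1) * n" unfolding S_def by simp
      then show ?thesis using I False unfolding I_def G_def by auto
    qed
    have fit1: "F i < (2 ^ w) ^ n" 
      using F_le[of i] i WW n w by (intro le_two_power_fits) auto
    have fit2: "G + F i < (2 ^ w) ^ n"
      using F_le[OF WW] n w unfolding FG by (intro le_two_power_fits) auto
    have add2: "wp w add_prog (\<lambda>t s2. t \<le> 20 * n + 10 \<and> I (Suc i) (set_reg 12 (D + n) s2) \<and>
        regs s2 12 = D \<and> regs s2 0 = n) (set_reg 11 (S - n) s1)"
      if s1: "\<forall>r < 20. r \<noteq> 11 \<longrightarrow> regs s1 r = regs s' r" "\<forall>a. a < D \<or> D + n \<le> a \<longrightarrow> mem s1 a = mem s' a"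
        "\<forall>j < n. mem s1 (D + j) < 2 ^ w" "bval w n (mem s1) D = F i" for s1
    proof -
      have low: "mem s1 (S - n + j) = mem s' (S - n + j)" if "j < n" for j
        using s1 SD DS that by auto
      have b: "bval w n (mem s1) (S - n) = G" using S' bval_cong[of n "mem s1" "S - n" "mem s'" w] low by simp
      show ?thesis
      proof (rule wp_mono[OF add_spec[of _ n "S - n" D w]], goal_cases)
        \<comment> \<open>Goals 1 to 11 are the hypotheses of \<open>add_spec\<close>; goal 12 is
          the passage to the new invariant.\<close>
        case (12 t s2)
        have old: "(\<forall>j < n. mem s2 (T + e * n + j) < 2 ^ w) \<and> bval w n (mem s2) (T + e * n) = F e"
          if e: "e < W + i" for e
        proof -
          have "(e + 1) * n \<le> (W + i) * n" using e by (intro mult_right_mono) auto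
          then have eq: "mem s2 (T + e * n + j) = mem s' (T + e * n + j)" if "j < n" for j
            using 12 s1 that unfolding D_def by simp
          show ?thesis
            using I e eq bval_cong[of n "mem s2" "T + e * n" "mem s'" w] unfolding I_def by simp
        qed
        have new: "(\<forall>j < n. mem s2 (D + j) < 2 ^ w) \<and> bval w n (mem s2) D = F (W + i)"
          using 12 b s1 FG by simp
        have all: "(\<forall>j < n. mem s2 (T + e * n + j) < 2 ^ w) \<and> bval w n (mem s2) (T + e * n) = F e"
          if e: "e < W + Suc i" for e
        proof (cases "e = W + i")
          case True
          then show ?thesis using new unfolding D_def by simp
        qed (use old e in auto)
        have "T \<le> D" unfolding D_def by simp
        moreover have "D + n = T + (W + Suc i) * n" unfolding D_def by simp
        moreover have "D \<le> D + n" by simp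
        ultimately show ?case
          using 12 s1 I r all unfolding I_def D_def[symmetric] by auto
      qed (use s1 r SD DS D w n S' low b fit2 in auto)
    qed
    have "wp w pascal_body (\<lambda>t s'. t \<le> 40 * n + 29 \<and> I (Suc i) s') s'"
      unfolding pascal_body_def using r D DS
      apply simp
      apply (rule wp_mono[OF add_spec[of _ n S D w]])
      apply (use r SD D w n wS zeroD bS bD fit1 in simp_all)
      subgoal for t1 s1
        apply (rule wp_mono[OF add2[of s1]])
        apply auto
        done
      done
    moreover have "D < T + W * W * n" using D n by simp
    ultimately show ?thesis using r by simp
  qed
  have bT: "(\<forall>j < n. mem s (T + e * n + j) < 2 ^ w) \<and> bval w n (mem s) (T + e * n) = F e" if "e < W" for e
  proof (cases "e = 0")
    case True
    have "bval w n (mem s) T = (\<Sum>i<n. if i = 0 then 1 else 0)"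
      unfolding bval_def using mem by (intro sum.cong) auto
    also have "\<dots> = 1" using n by simp
    finally have "bval w n (mem s) T = 1" .
    moreover have "mem s (T + j) < 2 ^ w" for j
      using mem one by (cases "j = 0") simp_all
    ultimately show ?thesis using True by (simp add: F_def)
  next
    case False
    then have "mem s (T + e * n + j) = 0" for j using n by (intro mem) auto
    then show ?thesis using False that by (simp add: bval_def F_def)
  qed
  have WW: "W * W = W + n * W" using W by simp
  have I0: "I 0 s"
    unfolding I_def using bT regs n W by (auto intro!: mem)
  show ?thesis
    unfolding pascal_prog_def
    apply (rule wp_mono[OF wp_Loop[where I = I and N = "n * W" and T = "40 * n + 29", OF I0 step]])
    apply assumption
    apply assumption
    subgoal using regs unfolding I_def WW by simp
    subgoal unfolding I_def WW F_def by (simp add: add.commute)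
    done
qed

section \<open>The loop over all tuples\<close>

context odometer
begin

definition weight :: "(nat \<Rightarrow> nat) \<Rightarrow> nat list \<Rightarrow> nat" where
  "weight c q = (if ind_path R q then c (card {v \<in> {..<n}. leg R q v}) else 0)"

text \<open>One column of a table with row distance \<open>d\<close>. Leaving \<open>c\<close>
  abstract keeps binomial coefficients out of the loop proofs.\<close>

definition table :: "(nat \<Rightarrow> nat) \<Rightarrow> nat \<Rightarrow> nat \<Rightarrow> ram_state \<Rightarrow> bool" where
  "table c S d s \<longleftrightarrow> (\<forall>m \<le> n. bval w n (mem s) (S + m * d) = c m \<and>
     (\<forall>j < n. mem s (S + m * d + j) < 2 ^ w))"

lemma table_cong:
  assumes "table c S d s" "S + n * d + n \<le> D" "\<forall>a < D. mem s' a = mem s a"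
  shows "table c S d s'"
  unfolding table_def
proof (intro allI impI)
  fix m assume m: "m \<le> n"
  then have "m * d \<le> n * d" by simp
  then have "S + m * d + j < D" if "j < n" for j using assms(2) that by linarith
  then have eq: "mem s' (S + m * d + j) = mem s (S + m * d + j)" if "j < n" for j
    using assms(3) that by simp
  then have "bval w n (mem s') (S + m * d) = bval w n (mem s) (S + m * d)" by (rule bval_cong)
  with eq m assms(1) show "bval w n (mem s') (S + m * d) = c m \<and> (\<forall>j < n. mem s' (S + m * d + j) < 2 ^ w)"
    unfolding table_def by simp
qed

lemma tuple_spec:
  assumes s: "ready (digits n L x) s" and x: "x < n ^ L"
    and regs: "regs s 8 = S" "regs s 9 = d" "regs s 12 = D"
    and addr: "n * n \<le> S" "S + n * d + n \<le> D" "D + n \<le> A"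
    and tab: "table c S d s" and words: "\<forall>j < n. mem s (D + j) < 2 ^ w"
    and fits: "bval w n (mem s) D + weight c (digits n L x) < (2 ^ w) ^ n"
  shows "wp w tuple_body (\<lambda>t s'. t \<le> L * (25 * L + 20) + n * (25 * L + 25) + 20 * n + 20 * L + 60 \<and>
    ready (digits n L (Suc x)) s' \<and> (\<forall>r < 13. r \<noteq> 10 \<and> r \<noteq> 11 \<longrightarrow> regs s' r = regs s r) \<and>
    regs s' 10 = Suc x div n ^ L \<and> (\<forall>a < D. mem s' a = mem s a) \<and>
    (\<forall>j < n. mem s' (D + j) < 2 ^ w) \<and>
    bval w n (mem s') D = bval w n (mem s) D + weight c (digits n L x)) s"
proof -
  define q where "q = digits n L x"
  define Tm where "Tm = L * (25 * L + 20) + n * (25 * L + 25) + 20 * n"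
  \<comment> \<open>The state before \<open>incr_prog\<close>, common to both branches of the path
    test.\<close>
  define P where "P s' \<longleftrightarrow> ready q s' \<and> (\<forall>r < 13. r \<noteq> 11 \<longrightarrow> regs s' r = regs s r) \<and>
    (\<forall>a < D. mem s' a = mem s a) \<and> (\<forall>j < n. mem s' (D + j) < 2 ^ w) \<and>
    bval w n (mem s') D = bval w n (mem s) D + weight c q" for s'
  have incr: "wp w incr_prog (\<lambda>t s'. t \<le> 20 * L + 10 \<and>
    ready (digits n L (Suc x)) s' \<and> (\<forall>r < 13. r \<noteq> 10 \<and> r \<noteq> 11 \<longrightarrow> regs s' r = regs s r) \<and>
    regs s' 10 = Suc x div n ^ L \<and> (\<forall>a < D. mem s' a = mem s a) \<and>
    (\<forall>j < n. mem s' (D + j) < 2 ^ w) \<and>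
    bval w n (mem s') D = bval w n (mem s) D + weight c (digits n L x)) s1" if P: "P s1" for s1
  proof (rule wp_mono[OF incr_spec[of x s1]])
    show "ready (digits n L x) s1" using P unfolding P_def q_def by simp
    show "x < n ^ L" by (rule x)
  next
    fix t s2
    assume s2: "t \<le> 20 * L + 10 \<and> ready (digits n L (Suc x)) s2 \<and>
      (\<forall>a < A. mem s2 a = mem s1 a) \<and> (\<forall>r < 20. r \<noteq> 10 \<longrightarrow> regs s2 r = regs s1 r) \<and>
      regs s2 10 = Suc x div n ^ L"
    have "bval w n (mem s2) D = bval w n (mem s1) D" using s2 addr by (intro bval_cong) simp
    then show "t \<le> 20 * L + 10 \<and>
      ready (digits n L (Suc x)) s2 \<and> (\<forall>r < 13. r \<noteq> 10 \<and> r \<noteq> 11 \<longrightarrow> regs s2 r = regs s r) \<and>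
      regs s2 10 = Suc x div n ^ L \<and> (\<forall>a < D. mem s2 a = mem s a) \<and>
      (\<forall>j < n. mem s2 (D + j) < 2 ^ w) \<and>
      bval w n (mem s2) D = bval w n (mem s) D + weight c (digits n L x)"
      using s2 P addr unfolding P_def q_def by auto
  qed
  have legs: "wp w (block [legs_prog, add_prog])
      (\<lambda>t s2. t \<le> n * (25 * L + 25) + 20 * n + 25 \<and> P s2) s1"
    if path: "ind_path R q" and s1: "mem s1 = mem s" "\<forall>r < 13. regs s1 r = regs s r" for s1
  proof -
    define m where "m = card {v \<in> {..<n}. leg R q v}"
    have m: "m \<le> n"
      unfolding m_def using card_mono[of "{..<n}" "{v \<in> {..<n}. leg R q v}"] by fastforce
    then have "m * d \<le> n * d" by simp
    then have md: "S + m * d + n \<le> D" using addr by linarith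
    have ready: "ready q s1" using s[folded q_def] s1 by (auto elim!: ready_cong)
    have weight: "weight c q = c m" using path unfolding weight_def m_def by simp
    show ?thesis
      apply simp
      apply (rule wp_mono[OF legs_spec[of q, OF ready]])
      subgoal using s1 regs addr A by simp
      subgoal premises p2 for t2 s2
      proof -
        have r2: "regs s2 11 = S + m * d" "regs s2 12 = D" "regs s2 0 = n" "regs s2 4 = 1" "mem s2 = mem s"
          using p2 s1 regs s unfolding m_def ready_def by auto
        have b: "bval w n (mem s) (S + m * d) = c m" "\<forall>j < n. mem s (S + m * d + j) < 2 ^ w"
          using tab m unfolding table_def by auto
        show ?thesis
          apply simp
          apply (rule wp_mono[OF add_spec[of _ n "S + m * d" D w]])
          apply (use r2 b md addr A n w words fits weight in \<open>simp_all add: q_def[symmetric]\<close>)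
          subgoal premises p3 for t3 s3
          proof -
            have "u * n + v < D" if "u < n" "v < n" for u v
              using matrix_index_less[OF that] addr by simp
            then have "ready q s3"
              using ready p2 p3 s1 r2 addr unfolding ready_def by auto
            then show ?thesis using p2 p3 s1 r2 weight unfolding P_def by auto
          qed
          done
      qed
      done
  qed
  have ite: "wp w (Ite (Eq 15 4) (block [legs_prog, add_prog]) Nop)
      (\<lambda>t s2. t \<le> n * (25 * L + 25) + 20 * n + 26 \<and> P s2) s1"
    if s1: "mem s1 = mem s" "\<forall>r < 13. regs s1 r = regs s r" "regs s1 15 = of_bool (ind_path R q)" for s1
  proof (cases "ind_path R q")
    case True
    then have "regs s1 15 = regs s1 4" using s1 s unfolding ready_def by simp
    then show ?thesis
      using wp_mono[OF legs[OF True s1(1,2)]] by (simp del: wp_block)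
  next
    case False
    then have "regs s1 15 \<noteq> regs s1 4" using s1 s unfolding ready_def by simp
    moreover have "P s1"
      using s1 False words s[folded q_def] unfolding P_def weight_def by (auto elim!: ready_cong)
    ultimately show ?thesis by simp
  qed
  show ?thesis
    unfolding tuple_body_def
    apply simp
    apply (rule wp_mono[OF path_spec[OF s]])
    apply (simp del: wp_Ite)
    apply (rule wp_mono[OF ite])
    apply (simp_all add: q_def)
    apply (rule wp_mono[OF incr])
    apply auto
    done
qed

lemma tuples_spec:
  assumes s: "ready (digits n L 0) s" "regs s 10 = 0" and n0: "0 < n"
    and regs: "regs s 8 = S" "regs s 9 = d" "regs s 12 = D"
    and addr: "n * n \<le> S" "S + n * d + n \<le> D" "D + n \<le> A"
    and tab: "table c S d s" and zero: "\<forall>j < n. mem s (D + j) = 0"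
    and fits: "(\<Sum>q | length q = L \<and> set q \<subseteq> {..<n}. weight c q) < (2 ^ w) ^ n"
  shows "wp w tuples_prog (\<lambda>t s'.
    t \<le> n ^ L * (L * (25 * L + 20) + n * (25 * L + 25) + 20 * n + 20 * L + 61) + 1 \<and>
    (\<forall>r < 10. regs s' r = regs s r) \<and>
    bval w n (mem s') D = (\<Sum>q | length q = L \<and> set q \<subseteq> {..<n}. weight c q)) s"
proof -
  define f where "f y = weight c (digits n L y)" for y
  have total: "(\<Sum>y < n ^ L. f y) = (\<Sum>q | length q = L \<and> set q \<subseteq> {..<n}. weight c q)"
    unfolding f_def by (rule sum.reindex_bij_betw[OF bij_betw_digits[OF n0]])
  define I where "I x s' \<longleftrightarrow> ready (digits n L x) s' \<and>
    (\<forall>r < 13. r \<noteq> 10 \<and> r \<noteq> 11 \<longrightarrow> regs s' r = regs s r) \<and> regs s' 10 = x div n ^ L \<and>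
    (\<forall>a < D. mem s' a = mem s a) \<and> (\<forall>j < n. mem s' (D + j) < 2 ^ w) \<and>
    bval w n (mem s') D = (\<Sum>y < x. f y)" for x s'
  define t0 where "t0 = L * (25 * L + 20) + n * (25 * L + 25) + 20 * n + 20 * L + 60"
  have step: "holds (Eq 10 3) s' \<and> wp w tuple_body (\<lambda>t s'. t \<le> t0 \<and> I (Suc x) s') s'"
    if x: "x < n ^ L" and I: "I x s'" for x s'
  proof
    show "holds (Eq 10 3) s'" using x I unfolding I_def ready_def by simp
    \<comment> \<open>All summands are natural numbers, so partial sums stay below the total, which
      fits.\<close>
    have "(\<Sum>y < Suc x. f y) \<le> (\<Sum>y < n ^ L. f y)"
      using x by (intro sum_mono2) auto
    then have fit: "(\<Sum>y < x. f y) + f x < (2 ^ w) ^ n" using fits total by simp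
    show "wp w tuple_body (\<lambda>t s'. t \<le> t0 \<and> I (Suc x) s') s'"
      apply (rule wp_mono[OF tuple_spec[of x s' S d D c]])
      subgoal using I unfolding I_def by blast
      subgoal by (rule x)
      subgoal using I regs unfolding I_def by simp
      subgoal using I regs unfolding I_def by simp
      subgoal using I regs unfolding I_def by simp
      subgoal by (rule addr)
      subgoal by (rule addr)
      subgoal by (rule addr)
      subgoal using I table_cong[OF tab addr(2)] unfolding I_def by simp
      subgoal using I unfolding I_def by simp
      subgoal using I fit unfolding I_def f_def by simp
      subgoal using I unfolding I_def t0_def by (simp add: f_def)
      done
  qed
  have I0: "I 0 s" using s zero unfolding I_def by (simp add: bval_def)
  have "wp w tuples_prog (\<lambda>t s'. t \<le> n ^ L * (t0 + 1) + 1 \<and> I (n ^ L) s') s"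
    unfolding tuples_prog_def using step
    by (rule wp_Loop[where I = I, OF I0]) (use n0 in \<open>simp_all add: I_def ready_def\<close>)
  then show ?thesis
    by (rule wp_mono) (simp add: I_def total t0_def algebra_simps)
qed

end

section \<open>The algorithm\<close>

lemma init_spec:
  assumes regs: "regs s 0 = n" "regs s 1 = l" "regs s 2 = k" "regs s 3 = 0" "regs s 10 = 0"
    and k: "l + 2 \<le> k" "k \<le> n"
    and W: "W = n + 1" and T: "T = n * n + n" and D: "D = T + W * W * n" and fits: "D + n < 2 ^ w"
  shows "wp w init_prog (\<lambda>t s'. t \<le> 16 \<and> regs s' 0 = n \<and> regs s' 3 = 0 \<and> regs s' 4 = 1 \<and>
    regs s' 5 = l + 2 \<and> regs s' 6 = D + n \<and> regs s' 7 = D \<and>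
    regs s' 8 = T + (k - (l + 2)) * n \<and> regs s' 9 = W * n \<and> regs s' 10 = 0 \<and>
    regs s' 12 = T + W * n \<and> mem s' = (mem s)(T := 1)) s"
proof -
  \<comment> \<open>The nonlinear products get names so that linear arithmetic can treat them as
    atoms.\<close>
  define sq Wn WWn j where defs: "sq = n * n" "Wn = W * n" "WWn = W * Wn" "j = k - (l + 2)"
  define jn where "jn = j * n"
  define S0 where "S0 = T + jn"
  define D0 where "D0 = T + Wn"
  define A where "A = D + n"
  have D': "D = T + WWn" and T': "T = sq + n" unfolding D T defs by (simp_all add: mult.assoc)
  have A: "A < 2 ^ w" using fits by (simp add: A_def)
  have n: "2 \<le> n" using k by simp
  have "j \<le> W" unfolding defs using k W by linarith
  then have jn: "jn \<le> Wn" unfolding jn_def defs by simp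
  have Wn: "Wn \<le> WWn" "W \<le> Wn" unfolding defs using W n by simp_all
  have bounds: "2 < (2 :: nat) ^ w" "l + 2 < 2 ^ w" "sq < 2 ^ w" "T < 2 ^ w" "W < 2 ^ w" "Wn < 2 ^ w"
    "WWn < 2 ^ w" "D < 2 ^ w" "k < 2 ^ w" "jn < 2 ^ w" "S0 < 2 ^ w" "D0 < 2 ^ w"
    using A Wn jn n W k unfolding A_def D' T' S0_def D0_def by linarith+
  have times: "word_arith w Times W n = Wn" "word_arith w Times W Wn = WWn" "word_arith w Times j n = jn"
    using bounds(6,7,10) word_arith_exact(3)[of W n w] word_arith_exact(3)[of W Wn w]
      word_arith_exact(3)[of j n w]
    unfolding defs(2,3) jn_def by blast+
  have ops: "word_arith w Plus l 2 = l + 2" "word_arith w Times n n = sq" "word_arith w Plus sq n = T"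
    "word_arith w Plus n (Suc 0) = W" 
    "word_arith w Plus T WWn = D" "word_arith w Plus D n = A" "word_arith w Minus k (l + 2) = j"
    "word_arith w Plus T jn = S0" "word_arith w Plus T Wn = D0"
    using bounds A k W
    by (simp_all add: defs(1)[symmetric] defs(4) S0_def[symmetric] D0_def[symmetric]
      A_def[symmetric] D'[symmetric] T'[symmetric] del: add_2_eq_Suc add_2_eq_Suc')
  have w: "0 < w" using bounds(1) by (cases w) auto
  have "wp w init_prog (\<lambda>t s'. t \<le> 16 \<and> regs s' 0 = n \<and> regs s' 3 = 0 \<and> regs s' 4 = 1 \<and>
    regs s' 5 = l + 2 \<and> regs s' 6 = A \<and> regs s' 7 = D \<and> regs s' 8 = S0 \<and> regs s' 9 = Wn \<and>
    regs s' 10 = 0 \<and> regs s' 12 = D0 \<and> mem s' = (mem s)(T := 1)) s"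
    unfolding init_prog_def using bounds(1) w
    by (simp add: regs regs(2)[simplified] ops times del: word_arith_exact add_2_eq_Suc add_2_eq_Suc')
  then show ?thesis by (rule wp_mono) (simp add: A_def S0_def D0_def jn_def defs)
qed

lemma count_induced_scorpions_le_two_power:
  assumes "finite (pverts G)" "card (pverts G) = n"
  shows "count_induced_scorpions l k G \<le> 2 ^ n"
proof -
  have "count_induced_scorpions l k G \<le> card (Pow (pverts G))"
    unfolding count_induced_scorpions_def using assms by (intro card_mono) auto
  then show ?thesis using assms by (simp add: card_Pow)
qed

lemma count_induced_scorpions_eq_0:
  assumes "finite (pverts G)" "card (pverts G) < k"
  shows "count_induced_scorpions l k G = 0"
proof -
  have "{X. X \<subseteq> pverts G \<and> card X = k \<and> scorpion l (with_proj G \<restriction> X)} = {}"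
    using card_mono[OF assms(1)] assms(2) by (auto simp: not_less[symmetric])
  then show ?thesis unfolding count_induced_scorpions_def by (simp only: card.empty)
qed

text \<open>\<open>L \<le> n\<close> absorbs the quadratic path test into \<open>L * n\<close>. The
  coefficients 25, 40, 25, 45, 61 add up to 196, rounded to 200, and \<open>L \<le> 3 * l\<close>
  makes this 600; Pascal's triangle adds 140 and the rest 30, within 1000.\<close>

lemma time_bound:
  fixes l n :: nat
  assumes l: "1 \<le> l" and ln: "l + 4 \<le> n"
  defines "L \<equiv> l + 2"
  shows "n * (n + 1) * (40 * n + 30) +
    n ^ L * (L * (25 * L + 20) + n * (25 * L + 25) + 20 * n + 20 * L + 61) + 30
    \<le> 1000 * (l * n ^ (l + 3))"
proof -
  have L: "L \<le> n" "L \<le> 3 * l" "1 \<le> L" "1 \<le> n" using assms by auto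
  have step: "n ^ (l + 3) = n ^ L * n" unfolding L_def by (simp add: eval_nat_numeral)
  have 1: "L * L \<le> L * n" "L * 1 \<le> L * n" "1 * n \<le> L * n" "1 * 1 \<le> L * n"
    using L by simp_all
  have "L * (25 * L + 20) + n * (25 * L + 25) + 20 * n + 20 * L + 61
      = 25 * (L * L) + 40 * (L * 1) + 25 * (L * n) + 45 * (1 * n) + 61 * (1 * 1)"
    by (simp add: algebra_simps)
  also have "\<dots> \<le> 200 * (L * n)" using 1 by linarith
  also have "\<dots> \<le> 200 * (3 * l * n)" using L by (intro mult_left_mono mult_right_mono) auto
  finally have "n ^ L * (L * (25 * L + 20) + n * (25 * L + 25) + 20 * n + 20 * L + 61)
      \<le> n ^ L * (600 * l * n)" by (intro mult_left_mono) auto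
  also have "\<dots> = 600 * (l * n ^ (l + 3))" unfolding step by (simp only: mult_ac)
  finally have A: "n ^ L * (L * (25 * L + 20) + n * (25 * L + 25) + 20 * n + 20 * L + 61)
    \<le> 600 * (l * n ^ (l + 3))" .
  have "n * (n + 1) * (40 * n + 30) \<le> n * (2 * n) * (70 * n)"
    using L by (intro mult_mono) auto
  also have "\<dots> = 140 * n ^ 3" by (simp add: power3_eq_cube)
  finally have B: "n * (n + 1) * (40 * n + 30) \<le> 140 * n ^ 3" .
  have "1 * n ^ 3 \<le> l * n ^ (l + 3)"
    using L l by (intro mult_mono power_increasing) auto
  moreover have "1 \<le> n ^ 3" using L by simp
  ultimately show ?thesis using A B by linarith
qed

lemma scorpion_prog_correct:
  assumes l: "1 \<le> l" "l + 4 \<le> k" and k: "k \<le> n" and G: "pair_graph G" "pverts G = {..<n}"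
    and w: "admissible_word_size 4 w n l k"
  shows "wp w scorpion_prog (\<lambda>t s. has_output w s (count_induced_scorpions l k G) \<and>
    t \<le> 1000 * (l * n ^ (l + 3))) (input_state n l k G)"
proof -
  define R where "R u v \<longleftrightarrow> (u, v) \<in> parcs G" for u v
  define W L T where "W = n + 1" and "L = l + 2" and "T = n * n + n"
  define D where "D = T + W * W * n"
  define j where "j = k - L"
  have n5: "5 \<le> n" using l k by simp
  define N where "N = n + l + k + 2"
  \<comment> \<open>This bounds all memory in use. It is cubic in \<open>n\<close> plus a term
    linear in \<open>l\<close>, and \<open>N ^ 3 + N \<le> N ^ 4\<close> as
    \<open>N \<ge> 2\<close>: hence the exponent 4.\<close>
  have fits: "D + n + L + 2 < 2 ^ w"
  proof -
    have "D + n + L + 2 = (n + 1) ^ 3 + l + 3"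
      unfolding D_def T_def W_def L_def by (simp add: algebra_simps power3_eq_cube)
    also have "\<dots> < N ^ 3 + N"
    proof -
      have "(n + 1) ^ 3 \<le> N ^ 3" by (rule power_mono) (simp_all add: N_def)
      moreover have "l + 3 < N" using k l by (simp add: N_def)
      ultimately show ?thesis by linarith
    qed
    also have "\<dots> \<le> N ^ 3 + N ^ 3" using self_le_power[of N 3] unfolding N_def by simp
    also have "\<dots> = 2 * N ^ 3" by simp
    also have "\<dots> \<le> N * N ^ 3" unfolding N_def by (intro mult_right_mono) auto
    also have "\<dots> = N ^ 4" by (simp add: eval_nat_numeral)
    also have "\<dots> \<le> 2 ^ w" using w unfolding admissible_word_size_def N_def .
    finally show ?thesis .
  qed
  have w2: "2 \<le> w"
  proof (rule ccontr)
    assume "\<not> 2 \<le> w"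
    then have "(2 :: nat) ^ w \<le> 2 ^ 1" by (intro power_increasing) auto
    then show False using fits by simp
  qed
  interpret odometer w n L "D + n" R
    using fits w2 by unfold_locales (auto simp: D_def T_def)
  define c where "c m = (m choose j)" for m
  have sum: "(\<Sum>q | length q = L \<and> set q \<subseteq> {..<n}. weight c q) = count_induced_scorpions l k G"
    unfolding count_induced_scorpions_eq_sum[OF G(1) l] G(2) weight_def c_def j_def L_def R_def ..
  have count: "count_induced_scorpions l k G < (2 ^ w) ^ n"
  proof (rule le_two_power_fits)
    show "count_induced_scorpions l k G \<le> 2 ^ n"
      by (rule count_induced_scorpions_le_two_power) (simp_all add: G)
  qed (use n5 w2 in simp_all)
  let ?s = "input_state n l k G"
  have init: "wp w init_prog (\<lambda>t s'. t \<le> 16 \<and> regs s' 0 = n \<and> regs s' 3 = 0 \<and> regs s' 4 = 1 \<and>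
      regs s' 5 = L \<and> regs s' 6 = D + n \<and> regs s' 7 = D \<and> regs s' 8 = T + j * n \<and>
      regs s' 9 = W * n \<and> regs s' 10 = 0 \<and> regs s' 12 = T + W * n \<and>
      mem s' = (mem ?s)(T := 1)) ?s"
    unfolding L_def j_def
  proof (rule init_spec)
    show "D + n < 2 ^ w" using fits by linarith
  qed (use l k in \<open>simp_all add: input_state_def W_def T_def D_def\<close>)
  have mem0: "mem ?s a = 0" if "n * n \<le> a" for a using that by (simp add: input_state_def)
  have adj: "mem ?s (u * n + v) = of_bool (R u v)" if "u < n" "v < n" for u v
    using matrix_index_less[OF that] that by (simp add: input_state_def R_def)
  have jn: "j \<le> n" unfolding j_def using k by simp
  have fin: "wp w (block [pascal_prog, tuples_prog, Arith Plus 1 7 3])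
      (\<lambda>t s'. t \<le> n * W * (40 * n + 30) +
        n ^ L * (L * (25 * L + 20) + n * (25 * L + 25) + 20 * n + 20 * L + 61) + 10 \<and>
        has_output w s' (count_induced_scorpions l k G)) s1"
    if s1: "regs s1 0 = n" "regs s1 3 = 0" "regs s1 4 = 1"
      "regs s1 5 = L" "regs s1 6 = D + n" "regs s1 7 = D" "regs s1 8 = T + j * n"
      "regs s1 9 = W * n" "regs s1 10 = 0" "regs s1 12 = T + W * n"
      "mem s1 = (mem ?s)(T := 1)" for s1
  proof -
    have pascal: "wp w pascal_prog (\<lambda>t s'. t \<le> n * W * (40 * n + 30) + 1 \<and>
      (\<forall>r < 11. regs s' r = regs s1 r) \<and> regs s' 12 = D \<and>
      (\<forall>a < T. mem s' a = mem s1 a) \<and> (\<forall>a \<ge> D. mem s' a = 0) \<and>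
      (\<forall>i < W * W. (\<forall>j < n. mem s' (T + i * n + j) < 2 ^ w) \<and>
        bval w n (mem s') (T + i * n) = (i div W choose (i mod W)))) s1"
      unfolding D_def
    proof (rule pascal_spec)
      show "mem s1 a = 0" if "T \<le> a + n" "a \<noteq> T" for a
        using that mem0[of a] by (simp add: s1 T_def)
      show "T + W * W * n + n < 2 ^ w" using fits unfolding D_def by linarith
      show "regs s1 7 = T + W * W * n" using s1 by (simp add: D_def)
      show "W = n + 1" by (rule W_def)
      show "n \<le> T" by (simp add: T_def)
    qed (use s1 n5 w2 in simp_all)
    have tuples: "wp w tuples_prog (\<lambda>t s'.
        t \<le> n ^ L * (L * (25 * L + 20) + n * (25 * L + 25) + 20 * n + 20 * L + 61) + 1 \<and>
        (\<forall>r < 10. regs s' r = regs s2 r) \<and>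
        bval w n (mem s') D = count_induced_scorpions l k G) s2"
      if s2: "\<forall>r < 11. regs s2 r = regs s1 r" "regs s2 12 = D"
        "\<forall>a < T. mem s2 a = mem s1 a" "\<forall>a \<ge> D. mem s2 a = 0"
        "\<forall>i < W * W. (\<forall>j < n. mem s2 (T + i * n + j) < 2 ^ w) \<and>
          bval w n (mem s2) (T + i * n) = (i div W choose (i mod W))" for s2
      unfolding sum[symmetric]
    proof (rule tuples_spec[where S = "T + j * n" and d = "W * n"])
      have "u * n + v < T \<and> u * n + v \<noteq> T" if "u < n" "v < n" for u v
        using matrix_index_less[OF that] unfolding T_def by simp
      then show "ready (digits n L 0) s2"
        unfolding ready_def using s1 s2 n5 adj by (auto simp: digits_def)
      show "table c (T + j * n) (W * n) s2"
        unfolding table_def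
      proof (intro allI impI)
        fix m assume m: "m \<le> n"
        have "j < W" using jn unfolding W_def by simp
        then have "(m * W + j) div W = m" "(m * W + j) mod W = j" by simp_all
        moreover have "m * W + j < W * W" using matrix_index_less[of m W j] m jn unfolding W_def by simp
        moreover have addr: "T + j * n + m * (W * n) = T + (m * W + j) * n"
          by (simp add: algebra_simps)
        ultimately show "bval w n (mem s2) (T + j * n + m * (W * n)) = c m \<and>
            (\<forall>i < n. mem s2 (T + j * n + m * (W * n) + i) < 2 ^ w)"
          using s2(5)[rule_format, of "m * W + j"] unfolding c_def addr by simp
      qed
      have "j * n \<le> n * n" using jn by (rule mult_right_mono) simp
      moreover have "W * W * n = n * (W * n) + n * n + n" unfolding W_def by (simp add: algebra_simps)
      ultimately show "T + j * n + n * (W * n) + n \<le> D" unfolding D_def by linarith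
      show "n * n \<le> T + j * n" by (simp add: T_def)
    qed (use s1 s2 n5 in \<open>simp_all add: count[folded sum]\<close>)
    show ?thesis
      apply simp
      apply (rule wp_mono[OF pascal])
      apply simp
      apply (rule wp_mono[OF tuples])
      apply simp_all
      subgoal for t2 s2 t3 s3
        using s1 fits by (simp add: has_output_def bval_def)
      done
  qed
  have "wp w (block [init_prog, pascal_prog, tuples_prog, Arith Plus 1 7 3])
      (\<lambda>t s'. t \<le> n * W * (40 * n + 30) +
        n ^ L * (L * (25 * L + 20) + n * (25 * L + 25) + 20 * n + 20 * L + 61) + 26 \<and>
        has_output w s' (count_induced_scorpions l k G)) ?s"
    apply (subst wp_block(2))
    apply (rule wp_mono[OF init])
    apply (rule wp_mono[OF fin])
    apply simp_all
    done
  moreover have "\<not> n < k" using k by simp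
  ultimately show ?thesis
    unfolding scorpion_prog_def using time_bound[of l n] l k
    by (auto simp: input_state_def W_def L_def simp del: wp_block elim!: wp_mono)
qed

text \<open>The time bound is guarded by \<open>1 \<le> n\<close> because for \<open>n = 0\<close>
  its right-hand side is 0, whereas every run takes at least one unit.\<close>

theorem theorem3p3:
  shows "\<exists>(P :: com) (C :: nat) (d :: nat). 1 \<le> d \<and>
    (\<forall>(l :: nat) (k :: nat) (n :: nat) (G :: nat pair_pre_digraph) (w :: nat).
       1 \<le> l \<longrightarrow> l + 4 \<le> k \<longrightarrow> pair_graph G \<longrightarrow> pverts G = {..<n} \<longrightarrow>
       admissible_word_size d w n l k \<longrightarrow>
       (\<exists>t s. exec w P (input_state n l k G) t s \<and>
          has_output w s (count_induced_scorpions l k G) \<and>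
          (1 \<le> n \<longrightarrow> t \<le> C * (l * n ^ (l + 3)))))"
proof (rule exI[of _ scorpion_prog], rule exI[of _ 1000], rule exI[of _ 4], intro conjI allI impI)
  fix l k n w :: nat and G :: "nat pair_pre_digraph"
  assume l: "1 \<le> l" "l + 4 \<le> k" and G: "pair_graph G" "pverts G = {..<n}"
    and w: "admissible_word_size 4 w n l k"
  have "wp w scorpion_prog (\<lambda>t s. has_output w s (count_induced_scorpions l k G) \<and>
      (1 \<le> n \<longrightarrow> t \<le> 1000 * (l * n ^ (l + 3)))) (input_state n l k G)"
  proof (cases "k \<le> n")
    case True
    show ?thesis by (rule wp_mono[OF scorpion_prog_correct[OF l True G w]]) simp
  next
    case False
    \<comment> \<open>In this branch register 1 still contains \<open>l\<close>, now read as the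
      address of an empty digit sequence, and \<open>has_output\<close> requires it to be at most
      \<open>2 ^ w\<close>.\<close>
    have "l \<le> n + l + k + 2" by simp
    also have "\<dots> \<le> (n + l + k + 2) ^ 4" by (intro self_le_power) auto
    also have "\<dots> \<le> 2 ^ w" using w unfolding admissible_word_size_def .
    finally have "l \<le> 2 ^ w" .
    then have "wp w scorpion_prog (\<lambda>t s. t = 2 \<and> has_output w s 0) (input_state n l k G)"
      using False unfolding scorpion_prog_def
      by (simp add: input_state_def has_output_def numeral_2_eq_2)
    moreover have "2 \<le> 1000 * (l * n ^ (l + 3))" if "1 \<le> n"
    proof -
      have "1 \<le> l * n ^ (l + 3)" using that l by simp
      then show ?thesis by linarith
    qed
    moreover have "count_induced_scorpions l k G = 0"
      using False G by (intro count_induced_scorpions_eq_0) auto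
    ultimately show ?thesis by (elim wp_mono) metis
  qed
  then show "\<exists>t s. exec w scorpion_prog (input_state n l k G) t s \<and>
      has_output w s (count_induced_scorpions l k G) \<and> (1 \<le> n \<longrightarrow> t \<le> 1000 * (l * n ^ (l + 3)))"
    unfolding wp_def by blast
qed simp

end
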